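(* Shields' conjecture has an affirmative answer for the class of quasi-homogeneous operators; that is, if $T$ is a quasi-homogeneous operator which is Möbius bounded, then there exists a constant $c>0$ such that $\|T^k\|\leq c(k+1)^{1/2}$ for all integers $k\geq 0$.
   Context: $\mathbb D$ is the open unit disc; Möb is the group of all biholomorphic automorphisms of $\mathbb D$. A bounded operator $T$ is Möbius bounded if $\sigma(T)\subseteq\overline{\mathbb D}$ and $\sup_{\varphi\in\text{Möb}}\|\varphi(T)\|<\infty$, where $\varphi(T)$ is defined by the holomorphic functional calculus. Shields' conjecture: if $T$ is a Möbius bounded operator on a Hilbert space, then there exists a constant $c>0$ such that $\|T^k\|\leq c(k+1)^{1/2}$ for all integers $k\geq 0$. For $\lambda>0$, $\mathcal H^{(\lambda)}$ is the reproducing kernel Hilbert space of holomorphic functions on $\mathbb D$ with kernel $K^{(\lambda)}(z,w)=(1-z\bar w)^{-\lambda}$. Quasi-homogeneous operators: let $n\geq 1$ be an integer and let $0<\lambda_0\leq\lambda_1\leq\dots\leq\lambda_{n-1}$ be $n$ positive real numbers such that the difference $\lambda_{i+1}-\lambda_i$ is a fixed number $\Lambda$ for all $0\leq i\leq n-2$. Let $T_i$, $0\leq i\leq n-1$, be the adjoint $M_z^*$ of the operator of multiplication by the coordinate function $z$ on $\mathcal H^{(\lambda_i)}$. For $0\leq i<j\leq n-1$ let $S_{i,j}$ be the linear map given by $S_{i,j}(K^{(\lambda_j)}(\cdot,w))=m_{i,j}\,\bar\partial^{(j-i-1)}K^{(\lambda_i)}(\cdot,w)$, $w\in\mathbb D$,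 where the $m_{i,j}$ are arbitrary complex numbers and $\bar\partial^{(r)}$ is the $r$-th derivative with respect to $\bar w$ (so if $S_{i,j}$ defines a bounded operator from $\mathcal H^{(\lambda_j)}$ to $\mathcal H^{(\lambda_i)}$, then $S_{i,j}^*f=\overline{m_{i,j}}f^{(j-i-1)}$ for $f\in\mathcal H^{(\lambda_i)}$). A quasi-homogeneous operator of rank $n$ is a bounded linear operator on $\mathcal H^{(\lambda_0)}\oplus\dots\oplus\mathcal H^{(\lambda_{n-1})}$ given by the upper triangular operator matrix with diagonal entries $T_0,\dots,T_{n-1}$, entries $S_{i,j}$ for $i<j$, and $0$ for $i>j$. *)

theory Defs
  imports
    "HOL-Complex_Analysis.Complex_Analysis"
    "HOL-Library.Function_Algebras"
begin

section \<open>Complex Hilbert spaces with explicit carriers\<close>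

class complex_vector = ab_group_add +
  fixes scaleC :: "complex \<Rightarrow> 'a \<Rightarrow> 'a"  (infixr "*\<^sub>C" 75)
  assumes scaleC_add_right: "a *\<^sub>C (x + y) = a *\<^sub>C x + a *\<^sub>C y"
    and scaleC_add_left: "(a + b) *\<^sub>C x = a *\<^sub>C x + b *\<^sub>C x"
    and scaleC_scaleC: "a *\<^sub>C (b *\<^sub>C x) = (a * b) *\<^sub>C x"
    and scaleC_one: "1 *\<^sub>C x = x"

instantiation complex :: complex_vector
begin
definition scaleC_complex :: "complex \<Rightarrow> complex \<Rightarrow> complex"
  where "scaleC_complex a x = a * x"
instance by standard (simp_all add: scaleC_complex_def algebra_simps)
end

instantiation "fun" :: (type, complex_vector) complex_vector
begin
definition scaleC_fun :: "complex \<Rightarrow> ('a \<Rightarrow> 'b) \<Rightarrow> 'a \<Rightarrow> 'b"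
  where "scaleC_fun a f = (\<lambda>x. a *\<^sub>C f x)"
instance
  by standard (simp_all add: scaleC_fun_def fun_eq_iff scaleC_add_right scaleC_add_left
      scaleC_scaleC scaleC_one)
end

text \<open>
  The spaces under consideration depend on real parameters, so a Hilbert space is a
  subset of an ambient complex vector space together with an inner product (linear in the
  first argument) that is meaningful only on that subset.
\<close>

record 'v inner_space =
  carrier :: "'v set"
  inner :: "'v \<Rightarrow> 'v \<Rightarrow> complex"

definition hnorm :: "'v inner_space \<Rightarrow> 'v \<Rightarrow> real"
  where "hnorm H x = sqrt (Re (inner_space.inner H x x))"

locale complex_hilbert_space =
  fixes H :: "'v::complex_vector inner_space"
  assumes zero_mem: "0 \<in> carrier H"
    and add_mem: "\<lbrakk>x \<in> carrier H; y \<in> carrier H\<rbrakk> \<Longrightarrow> x + y \<in> carrier H"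
    and scaleC_mem: "x \<in> carrier H \<Longrightarrow> a *\<^sub>C x \<in> carrier H"
    and inner_add_left: "\<lbrakk>x \<in> carrier H; y \<in> carrier H; z \<in> carrier H\<rbrakk>
      \<Longrightarrow> inner_space.inner H (x + y) z = inner_space.inner H x z + inner_space.inner H y z"
    and inner_scaleC_left: "\<lbrakk>x \<in> carrier H; y \<in> carrier H\<rbrakk>
      \<Longrightarrow> inner_space.inner H (a *\<^sub>C x) y = a * inner_space.inner H x y"
    and inner_commute: "\<lbrakk>x \<in> carrier H; y \<in> carrier H\<rbrakk>
      \<Longrightarrow> inner_space.inner H y x = cnj (inner_space.inner H x y)"
    and inner_nonneg: "x \<in> carrier H \<Longrightarrow> 0 \<le> Re (inner_space.inner H x x)"
    and inner_definite: "\<lbrakk>x \<in> carrier H; inner_space.inner H x x = 0\<rbrakk> \<Longrightarrow> x = 0"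
    and complete: "\<lbrakk>\<And>k. X k \<in> carrier H;
        \<And>e. e > 0 \<Longrightarrow> \<exists>N. \<forall>j\<ge>N. \<forall>k\<ge>N. hnorm H (X j - X k) < e\<rbrakk>
      \<Longrightarrow> \<exists>x\<in>carrier H. (\<lambda>k. hnorm H (X k - x)) \<longlonglongrightarrow> 0"

text \<open>
  Operators are functions on the ambient vector space; only their values on the carrier
  are relevant.
\<close>

definition bounded_operator ::
    "'v::complex_vector inner_space \<Rightarrow> 'w::complex_vector inner_space \<Rightarrow> ('v \<Rightarrow> 'w) \<Rightarrow> bool"
  where "bounded_operator H1 H2 A \<longleftrightarrow>
    (\<forall>x\<in>carrier H1. A x \<in> carrier H2) \<and>
    (\<forall>x\<in>carrier H1. \<forall>y\<in>carrier H1. A (x + y) = A x + A y) \<and>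
    (\<forall>a. \<forall>x\<in>carrier H1. A (a *\<^sub>C x) = a *\<^sub>C A x) \<and>
    (\<exists>C. \<forall>x\<in>carrier H1. hnorm H2 (A x) \<le> C * hnorm H1 x)"

definition op_norm :: "'v::complex_vector inner_space \<Rightarrow> ('v \<Rightarrow> 'v) \<Rightarrow> real"
  where "op_norm H A = (SUP x\<in>{x \<in> carrier H. hnorm H x \<le> 1}. hnorm H (A x))"

definition is_adjoint :: "'v::complex_vector inner_space \<Rightarrow> ('v \<Rightarrow> 'v) \<Rightarrow> ('v \<Rightarrow> 'v) \<Rightarrow> bool"
  where "is_adjoint H A B \<longleftrightarrow> bounded_operator H H A \<and> bounded_operator H H B \<and>
    (\<forall>x\<in>carrier H. \<forall>y\<in>carrier H. inner_space.inner H (A x) y = inner_space.inner H x (B y))"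

definition spectrum :: "'v::complex_vector inner_space \<Rightarrow> ('v \<Rightarrow> 'v) \<Rightarrow> complex set"
  where "spectrum H T = {z. \<not> (\<exists>B. bounded_operator H H B \<and>
    (\<forall>x\<in>carrier H. B (z *\<^sub>C x - T x) = x \<and> z *\<^sub>C B x - T (B x) = x))}"

definition resolvent :: "'v::complex_vector inner_space \<Rightarrow> ('v \<Rightarrow> 'v) \<Rightarrow> complex \<Rightarrow> 'v \<Rightarrow> 'v"
  where "resolvent H T z = inv_into (carrier H) (\<lambda>x. z *\<^sub>C x - T x)"

definition direct_sum ::
    "nat \<Rightarrow> (nat \<Rightarrow> 'v::complex_vector inner_space) \<Rightarrow> (nat \<Rightarrow> 'v) inner_space"
  where "direct_sum n H =
    \<lparr>carrier = {F. (\<forall>i<n. F i \<in> carrier (H i)) \<and> (\<forall>i\<ge>n. F i = 0)},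
     inner = (\<lambda>F G. \<Sum>i<n. inner_space.inner (H i) (F i) (G i))\<rparr>"

section \<open>Moebius boundedness\<close>

definition moeb :: "(complex \<Rightarrow> complex) set"
  where "moeb = {\<phi>. \<phi> holomorphic_on ball 0 1 \<and> bij_betw \<phi> (ball 0 1) (ball 0 1) \<and>
    inv_into (ball 0 1) \<phi> holomorphic_on ball 0 1}"

text \<open>
  Riesz--Dunford calculus for an operator \<open>T\<close> with spectrum in the closed unit disc and a
  function \<open>\<phi>\<close> on the open disc that extends to a holomorphic function \<open>f\<close> on a larger
  disc: \<open>B = \<phi>(T) = (1 / (2 \<pi> \<i>)) \<integral> f(z) (z - T)\<^sup>-\<^sup>1 dz\<close> over \<open>|z| = r\<close> for some \<open>r > 1\<close>, the
  operator-valued integral being expressed through its matrix coefficients.  Neither \<open>f\<close>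
  (identity theorem) nor \<open>r\<close> (Cauchy's theorem) influences the values of \<open>B\<close> on the carrier.
\<close>

definition is_functional_calculus :: "'v::complex_vector inner_space \<Rightarrow> ('v \<Rightarrow> 'v) \<Rightarrow>
    (complex \<Rightarrow> complex) \<Rightarrow> ('v \<Rightarrow> 'v) \<Rightarrow> bool"
  where "is_functional_calculus H T \<phi> B \<longleftrightarrow> bounded_operator H H B \<and>
    (\<exists>f r R. 1 < r \<and> r < R \<and> f holomorphic_on ball 0 R \<and> (\<forall>z\<in>ball 0 1. f z = \<phi> z) \<and>
      (\<forall>x\<in>carrier H. \<forall>y\<in>carrier H.
        ((\<lambda>z. f z * inner_space.inner H (resolvent H T z x) y) has_contour_integral
          2 * of_real pi * \<i> * inner_space.inner H (B x) y) (circlepath 0 r)))"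

definition moebius_bounded :: "'v::complex_vector inner_space \<Rightarrow> ('v \<Rightarrow> 'v) \<Rightarrow> bool"
  where "moebius_bounded H T \<longleftrightarrow> bounded_operator H H T \<and> spectrum H T \<subseteq> cball 0 1 \<and>
    (\<exists>M. \<forall>\<phi>\<in>moeb. \<exists>B. is_functional_calculus H T \<phi> B \<and> op_norm H B \<le> M)"

section \<open>The weighted spaces and quasi-homogeneous operators\<close>

text \<open>
  Functions on the disc are represented by functions on the plane that vanish outside the
  disc.  The first argument of the kernel is the parameter: \<open>disc_kernel \<lambda> w\<close> is
  \<open>K\<^sup>(\<^sup>\<lambda>\<^sup>)(\<cdot>, w)\<close>.  The principal power is the right branch, as the base has positive real part.
\<close>

definition disc_kernel :: "real \<Rightarrow> complex \<Rightarrow> complex \<Rightarrow> complex"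
  where "disc_kernel l w =
    (\<lambda>z. if z \<in> ball 0 1 then (1 - z * cnj w) powr (- of_real l) else 0)"

text \<open>
  The reproducing kernel Hilbert space with kernel \<open>K\<^sup>(\<^sup>\<lambda>\<^sup>)\<close>; these conditions determine the
  carrier and the inner product on it uniquely.
\<close>

definition is_weighted_space :: "real \<Rightarrow> (complex \<Rightarrow> complex) inner_space \<Rightarrow> bool"
  where "is_weighted_space l H \<longleftrightarrow> complex_hilbert_space H \<and>
    (\<forall>f\<in>carrier H. f holomorphic_on ball 0 1 \<and> (\<forall>z. z \<notin> ball 0 1 \<longrightarrow> f z = 0)) \<and>
    (\<forall>w\<in>ball 0 1. disc_kernel l w \<in> carrier H \<and>
      (\<forall>f\<in>carrier H. inner_space.inner H f (disc_kernel l w) = f w))"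

text \<open>
  For \<open>g\<close> antiholomorphic, the \<open>r\<close>-th derivative with respect to the conjugate of \<open>w\<close>: differentiate
  the holomorphic function \<open>u \<mapsto> g (cnj u)\<close> at \<open>u = cnj w\<close>.
\<close>

definition dbar :: "nat \<Rightarrow> (complex \<Rightarrow> complex) \<Rightarrow> complex \<Rightarrow> complex"
  where "dbar r g w = (deriv ^^ r) (\<lambda>u. g (cnj u)) (cnj w)"

definition dbar_kernel :: "nat \<Rightarrow> real \<Rightarrow> complex \<Rightarrow> complex \<Rightarrow> complex"
  where "dbar_kernel r l w = (\<lambda>z. dbar r (\<lambda>v. disc_kernel l v z) w)"

definition mult_z :: "(complex \<Rightarrow> complex) \<Rightarrow> complex \<Rightarrow> complex"
  where "mult_z f = (\<lambda>z. z * f z)"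

definition quasi_homogeneous :: "nat \<Rightarrow> (nat \<Rightarrow> real) \<Rightarrow>
    (nat \<Rightarrow> (complex \<Rightarrow> complex) inner_space) \<Rightarrow>
    ((nat \<Rightarrow> complex \<Rightarrow> complex) \<Rightarrow> nat \<Rightarrow> complex \<Rightarrow> complex) \<Rightarrow> bool"
  where "quasi_homogeneous n l H T \<longleftrightarrow>
    n \<ge> 1 \<and> 0 < l 0 \<and>
    (\<forall>i. Suc i < n \<longrightarrow> l i \<le> l (Suc i)) \<and>
    (\<exists>L. \<forall>i. Suc i < n \<longrightarrow> l (Suc i) - l i = L) \<and>
    (\<forall>i<n. is_weighted_space (l i) (H i)) \<and>
    bounded_operator (direct_sum n H) (direct_sum n H) T \<and>
    (\<exists>A m.
      (\<forall>i<n. \<forall>j<n. bounded_operator (H j) (H i) (A i j)) \<and>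
      (\<forall>i<n. is_adjoint (H i) mult_z (A i i)) \<and>
      (\<forall>i j. i < j \<and> j < n \<longrightarrow> (\<forall>w\<in>ball 0 1.
        A i j (disc_kernel (l j) w) = (m i j :: complex) *\<^sub>C dbar_kernel (j - i - 1) (l i) w)) \<and>
      (\<forall>i j. j < i \<and> i < n \<longrightarrow> (\<forall>f\<in>carrier (H j). A i j f = 0)) \<and>
      (\<forall>F\<in>carrier (direct_sum n H). \<forall>i<n. T F i = (\<Sum>j<n. A i j (F j))))"

end

theory Submission
  imports Defs
begin

text \<open>
  The monomials form an orthogonal basis of each weighted space, and the squared norm of \<open>z\<^sup>N\<close> is the
  reciprocal of the \<open>N\<close>-th Taylor coefficient \<open>\<kappa>(N)\<close> of \<open>(1 - x)\<^sup>-\<^sup>\<lambda>\<close>.  Give \<open>z\<^sup>N\<close> in the \<open>i\<close>-th summand the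
  degree \<open>N + i\<close>.  Then every entry of \<open>T\<close> lowers degrees by exactly one, so each block of \<open>T\<^sup>k\<close> is a
  weighted shift: \<open>\<langle>(T\<^sup>k F)\<^sub>i, z\<^sup>N\<rangle>\<close> is the sum over \<open>j \<ge> i\<close> of a scalar \<open>R\<^sub>k(j)\<close> times
  \<open>\<langle>F\<^sub>j, z\<^sup>N\<^sup>+\<^sup>k\<^sup>+\<^sup>i\<^sup>-\<^sup>j\<rangle>\<close> (\<open>coefficient_power\<close>).  The theorem amounts to the bound \<open>O(k + 1)\<close> for the squared entries
  \<open>|R\<^sub>k(j)|\<^sup>2\<close> after normalisation of the monomials.

  Such a bound holds in the mean.  For an automorphism \<open>\<phi>(z) = \<Sum>\<^sub>k c\<^sub>k z\<^sup>k\<close> the matrix entries of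
  \<open>\<phi>(T) = \<Sum>\<^sub>k c\<^sub>k T\<^sup>k\<close> that pair \<open>z\<^sup>N\<close> in the \<open>i\<close>-th summand with the monomials of the \<open>j\<close>-th one are the
  normalised \<open>c\<^sub>k R\<^sub>k(j)\<close>, each at a different monomial.  Thus \<open>\<Sum>\<^sub>k c\<^sub>k\<^sup>2 |R\<^sub>k(j)|\<^sup>2\<close>, normalised, is at most the square of the
  Moebius bound (\<open>path_coeff_square_sum\<close>).  For \<open>\<phi>(z) = (z - a) / (1 - a z)\<close> with \<open>1 - a\<close> of order \<open>1 / K\<close>
  the \<open>c\<^sub>k\<close> are of order \<open>1 / K\<close> on a block of \<open>k\<close> of length proportional to \<open>K\<close>, so the mean of the
  squared entries over that block is \<open>O(K)\<close>.

  The mean controls the single entry at \<open>K\<close>, because for fixed \<open>i\<close>, \<open>j\<close> and \<open>N\<close> the scalar \<open>R\<^sub>k(j)\<close> is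
  a polynomial in \<open>k\<close> whose degree is at most \<open>j - i\<close> (\<open>path_coeff_poly\<close>).  A polynomial is bounded at \<open>K\<close> by
  its values at \<open>K + h, K + 2 h, \<dots>\<close> for every step \<open>h\<close>, and averaging over \<open>h\<close> gives
  \<open>poly_below_le_average\<close>; over the block the
  coefficients \<open>\<kappa>\<close> grow at most by a constant factor (\<open>kernel_coeff_growth\<close>).  From the entries one passes to the norm of \<open>T\<^sup>k\<close> by Bessel's
  inequality (\<open>power_component_bound\<close>).

  The functional calculus is only evaluated at vectors with polynomial components.  A power of \<open>T\<close>
  annihilates them, so the resolvent is a finite sum there and Cauchy's formula for the Taylor
  coefficients gives \<open>\<phi>(T) = \<Sum>\<^sub>k c\<^sub>k T\<^sup>k\<close> on them (\<open>functional_calculus_nilpotent\<close>).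
\<close>

section \<open>Hilbert space basics\<close>

abbreviation ip :: "'v inner_space \<Rightarrow> 'v \<Rightarrow> 'v \<Rightarrow> complex"
  where "ip H \<equiv> inner_space.inner H"

lemma scaleC_zero_left [simp]: "0 *\<^sub>C x = (0 :: 'a :: complex_vector)"
  using scaleC_add_left[of 0 0 x] by simp

lemma scaleC_zero_right [simp]: "a *\<^sub>C 0 = (0 :: 'a :: complex_vector)"
  using scaleC_add_right[of a 0 0] by simp

lemma scaleC_minus_one: "(-1) *\<^sub>C x = - (x :: 'a :: complex_vector)"
proof -
  have "x + (-1) *\<^sub>C x = (1 + (-1)) *\<^sub>C x"
    by (simp only: scaleC_add_left scaleC_one)
  then have "x + (-1) *\<^sub>C x = 0" by simp
  then show ?thesis by (metis add.inverse_unique)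
qed

lemma scaleC_apply: "(a *\<^sub>C f) x = a *\<^sub>C f x"
  by (simp add: scaleC_fun_def)

definition bounded_functional :: "'v::complex_vector inner_space \<Rightarrow> ('v \<Rightarrow> complex) \<Rightarrow> bool"
  where "bounded_functional H L \<longleftrightarrow>
    (\<forall>x\<in>carrier H. \<forall>y\<in>carrier H. L (x + y) = L x + L y) \<and>
    (\<forall>a. \<forall>x\<in>carrier H. L (a *\<^sub>C x) = a * L x) \<and>
    (\<exists>C. \<forall>x\<in>carrier H. cmod (L x) \<le> C * hnorm H x)"

lemma hnorm_nonneg [simp]: "0 \<le> Re (ip H x x) \<Longrightarrow> 0 \<le> hnorm H x"
  by (simp add: hnorm_def)

context complex_hilbert_space
begin

lemma minus_mem: "x \<in> carrier H \<Longrightarrow> - x \<in> carrier H"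
  using scaleC_mem[of x "-1"] by (simp add: scaleC_minus_one)

lemma diff_mem: "x \<in> carrier H \<Longrightarrow> y \<in> carrier H \<Longrightarrow> x - y \<in> carrier H"
  using add_mem[of x "-y"] minus_mem by simp

lemma sum_mem: "(\<And>i. i \<in> I \<Longrightarrow> f i \<in> carrier H) \<Longrightarrow> sum f I \<in> carrier H"
  by (induction I rule: infinite_finite_induct) (auto intro: zero_mem add_mem)

lemmas mem_intros = zero_mem add_mem scaleC_mem diff_mem sum_mem

lemma inner_zero_left: "y \<in> carrier H \<Longrightarrow> ip H 0 y = 0"
  using inner_scaleC_left[of 0 y 0] zero_mem by simp

lemma inner_minus_left: "x \<in> carrier H \<Longrightarrow> y \<in> carrier H \<Longrightarrow> ip H (- x) y = - ip H x y"
  using inner_scaleC_left[of x y "-1"] by (simp add: scaleC_minus_one)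

lemma inner_diff_left:
  "\<lbrakk>x \<in> carrier H; y \<in> carrier H; z \<in> carrier H\<rbrakk> \<Longrightarrow> ip H (x - y) z = ip H x z - ip H y z"
  using inner_add_left[of x "-y" z] by (simp add: minus_mem inner_minus_left)

lemma inner_sum_left:
  "(\<And>i. i \<in> I \<Longrightarrow> f i \<in> carrier H) \<Longrightarrow> z \<in> carrier H \<Longrightarrow> ip H (sum f I) z = (\<Sum>i\<in>I. ip H (f i) z)"
  by (induction I rule: infinite_finite_induct)
    (auto simp: inner_zero_left inner_add_left sum_mem)

lemma inner_zero_right: "y \<in> carrier H \<Longrightarrow> ip H y 0 = 0"
  using inner_commute[of 0 y] zero_mem inner_zero_left by simp

lemma inner_add_right:
  "\<lbrakk>x \<in> carrier H; y \<in> carrier H; z \<in> carrier H\<rbrakk> \<Longrightarrow> ip H z (x + y) = ip H z x + ip H z y"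
  by (simp add: inner_commute[of _ z] inner_add_left add_mem)

lemma inner_diff_right:
  "\<lbrakk>x \<in> carrier H; y \<in> carrier H; z \<in> carrier H\<rbrakk> \<Longrightarrow> ip H z (x - y) = ip H z x - ip H z y"
  by (simp add: inner_commute[of _ z] inner_diff_left diff_mem)

lemma inner_scaleC_right:
  "\<lbrakk>x \<in> carrier H; z \<in> carrier H\<rbrakk> \<Longrightarrow> ip H z (a *\<^sub>C x) = cnj a * ip H z x"
  by (simp add: inner_commute[of _ z] inner_scaleC_left scaleC_mem)

lemma inner_sum_right:
  "(\<And>i. i \<in> I \<Longrightarrow> f i \<in> carrier H) \<Longrightarrow> z \<in> carrier H \<Longrightarrow> ip H z (sum f I) = (\<Sum>i\<in>I. ip H z (f i))"
  by (induction I rule: infinite_finite_induct)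
    (auto simp: inner_zero_right inner_add_right sum_mem)

lemma hnorm_ge_0 [simp]: "x \<in> carrier H \<Longrightarrow> 0 \<le> hnorm H x"
  by (simp add: inner_nonneg)

lemma hnorm_sq: "x \<in> carrier H \<Longrightarrow> (hnorm H x)\<^sup>2 = Re (ip H x x)"
  by (simp add: hnorm_def inner_nonneg)

lemma inner_self: "x \<in> carrier H \<Longrightarrow> ip H x x = of_real ((hnorm H x)\<^sup>2)"
  using inner_commute[of x x] hnorm_sq[of x] by (auto simp: complex_eq_iff)

lemma hnorm_zero [simp]: "hnorm H 0 = 0"
  by (simp add: hnorm_def inner_zero_left zero_mem)

lemma hnorm_eq_0D: "x \<in> carrier H \<Longrightarrow> hnorm H x = 0 \<Longrightarrow> x = 0"
  using inner_definite[of x] inner_self[of x] by simp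

lemma hnorm_scaleC: "x \<in> carrier H \<Longrightarrow> hnorm H (a *\<^sub>C x) = cmod a * hnorm H x"
proof -
  assume x: "x \<in> carrier H"
  have "ip H (a *\<^sub>C x) (a *\<^sub>C x) = (a * cnj a) * ip H x x"
    using x by (simp add: inner_scaleC_left inner_scaleC_right scaleC_mem)
  also have "\<dots> = of_real ((cmod a * hnorm H x)\<^sup>2)"
    using x by (simp only: complex_norm_square[symmetric] inner_self) (simp add: power_mult_distrib)
  finally have "(hnorm H (a *\<^sub>C x))\<^sup>2 = (cmod a * hnorm H x)\<^sup>2"
    using x by (simp add: hnorm_sq scaleC_mem)
  then show ?thesis using x by (simp add: scaleC_mem)
qed

lemma Cauchy_Schwarz:
  assumes x: "x \<in> carrier H" and y: "y \<in> carrier H"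
  shows "cmod (ip H x y) \<le> hnorm H x * hnorm H y"
proof (cases "y = 0")
  case True
  then show ?thesis using x by (simp add: inner_zero_right)
next
  case False
  then have ny: "hnorm H y > 0" using hnorm_eq_0D[OF y] hnorm_ge_0[OF y] by fastforce
  define s where "s = hnorm H y"
  have s0: "s > 0" using ny s_def by simp
  define c where "c = ip H x y / of_real (s\<^sup>2)"
  define u where "u = x - c *\<^sub>C y"
  have u: "u \<in> carrier H" unfolding u_def by (intro mem_intros x y)
  have yy: "ip H y y = of_real (s\<^sup>2)" using inner_self[OF y] s_def by simp
  have uy: "ip H u y = 0"
    using x y s0 by (simp add: u_def inner_diff_left scaleC_mem inner_scaleC_left yy c_def)
  have "ip H u u = ip H u x"
    using x y u uy by (simp add: u_def[of ] inner_diff_right scaleC_mem inner_scaleC_right)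
  also have "\<dots> = ip H x x - c * cnj (ip H x y)"
    using x y inner_commute[of x y]
    by (simp add: u_def inner_diff_left scaleC_mem inner_scaleC_left)
  also have "\<dots> = of_real ((hnorm H x)\<^sup>2) - of_real ((cmod (ip H x y))\<^sup>2 / s\<^sup>2)"
    by (simp add: c_def inner_self[OF x] complex_norm_square[symmetric])
  finally have "Re (ip H u u) = (hnorm H x)\<^sup>2 - (cmod (ip H x y))\<^sup>2 / s\<^sup>2"
    by (simp flip: of_real_power of_real_divide of_real_diff)
  then have "(cmod (ip H x y))\<^sup>2 / s\<^sup>2 \<le> (hnorm H x)\<^sup>2"
    using inner_nonneg[OF u] by simp
  then have "(cmod (ip H x y))\<^sup>2 \<le> (hnorm H x * s)\<^sup>2"
    using s0 by (simp add: field_simps)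
  then have "cmod (ip H x y) \<le> hnorm H x * s"
    using s0 x by (intro power2_le_imp_le[of "cmod (ip H x y)"]) auto
  then show ?thesis by (simp add: s_def)
qed

lemma hnorm_triangle:
  assumes x: "x \<in> carrier H" and y: "y \<in> carrier H"
  shows "hnorm H (x + y) \<le> hnorm H x + hnorm H y"
proof -
  have "ip H (x + y) (x + y) = ip H x x + ip H y y + (ip H x y + cnj (ip H x y))"
    using x y inner_commute[of x y] by (simp add: add_mem inner_add_left inner_add_right)
  then have "(hnorm H (x + y))\<^sup>2 = (hnorm H x)\<^sup>2 + (hnorm H y)\<^sup>2 + 2 * Re (ip H x y)"
    using x y by (simp add: hnorm_sq add_mem)
  also have "\<dots> \<le> (hnorm H x + hnorm H y)\<^sup>2"
    using Cauchy_Schwarz[OF x y] complex_Re_le_cmod[of "ip H x y"] by (simp add: power2_sum)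
  finally show ?thesis
    by (rule power2_le_imp_le) (use x y in simp)
qed

lemma hnorm_sum:
  "(\<And>i. i \<in> I \<Longrightarrow> f i \<in> carrier H) \<Longrightarrow> hnorm H (sum f I) \<le> (\<Sum>i\<in>I. hnorm H (f i))"
proof (induction I rule: infinite_finite_induct)
  case (insert i I)
  have "hnorm H (sum f (insert i I)) \<le> hnorm H (f i) + hnorm H (sum f I)"
    using insert by (simp add: hnorm_triangle sum_mem)
  then show ?case using insert by fastforce
qed auto

lemma complete_ordered:
  assumes X: "\<And>k. X k \<in> carrier H"
    and small: "\<And>\<epsilon>. \<epsilon> > 0 \<Longrightarrow> \<exists>N. \<forall>j\<ge>N. \<forall>k\<ge>j. hnorm H (X k - X j) < \<epsilon>"
  shows "\<exists>x\<in>carrier H. (\<lambda>k. hnorm H (X k - x)) \<longlonglongrightarrow> 0"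
proof (rule complete)
  fix \<epsilon> :: real assume "\<epsilon> > 0"
  then obtain N where N: "\<And>j k. j \<ge> N \<Longrightarrow> k \<ge> j \<Longrightarrow> hnorm H (X k - X j) < \<epsilon>"
    using small by blast
  have "hnorm H (X j - X k) = hnorm H (X k - X j)" for j k
    using hnorm_scaleC[of "X k - X j" "-1"] X by (simp add: scaleC_minus_one diff_mem)
  then have "hnorm H (X j - X k) < \<epsilon>" if "j \<ge> N" "k \<ge> N" for j k
    using N[of j k] N[of k j] that by (cases "j \<le> k") auto
  then show "\<exists>N. \<forall>j\<ge>N. \<forall>k\<ge>N. hnorm H (X j - X k) < \<epsilon>" by blast
qed (rule X)

lemma abs_summable_convergent:
  assumes x: "\<And>N. x N \<in> carrier H" and b: "\<And>N. hnorm H (x N) \<le> b N" and "summable b"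
  shows "\<exists>s\<in>carrier H. (\<lambda>P. hnorm H ((\<Sum>N<P. x N) - s)) \<longlonglongrightarrow> 0"
proof (rule complete_ordered)
  show "(\<Sum>N<P. x N) \<in> carrier H" for P by (intro sum_mem x)
  fix \<epsilon> :: real assume "\<epsilon> > 0"
  then obtain N where N: "\<And>m n. m \<ge> N \<Longrightarrow> norm (sum b {m..<n}) < \<epsilon>"
    using \<open>summable b\<close> unfolding summable_Cauchy by blast
  have "hnorm H ((\<Sum>N<k. x N) - (\<Sum>N<j. x N)) < \<epsilon>" if jk: "j \<ge> N" "k \<ge> j" for j k
  proof -
    have "(\<Sum>N<k. x N) - (\<Sum>N<j. x N) = sum x {j..<k}"
      unfolding lessThan_atLeast0 using jk by (intro sum_diff_nat_ivl) auto
    moreover have "hnorm H (sum x {j..<k}) \<le> (\<Sum>i=j..<k. hnorm H (x i))"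
      by (rule hnorm_sum) (rule x)
    moreover have "\<dots> \<le> sum b {j..<k}" by (intro sum_mono b)
    ultimately show ?thesis using N[OF jk(1), of k] by simp
  qed
  then show "\<exists>N. \<forall>j\<ge>N. \<forall>k\<ge>j. hnorm H ((\<Sum>N<k. x N) - (\<Sum>N<j. x N)) < \<epsilon>" by blast
qed

lemma bounded_functional_inner: "y \<in> carrier H \<Longrightarrow> bounded_functional H (\<lambda>x. ip H x y)"
  unfolding bounded_functional_def
  using Cauchy_Schwarz[of _ y]
  by (auto simp: inner_add_left inner_scaleC_left mult.commute intro!: exI[of _ "hnorm H y"])

lemma bounded_functional_sum:
  assumes "bounded_functional H L" "\<And>i. i \<in> I \<Longrightarrow> f i \<in> carrier H"
  shows "L (sum f I) = (\<Sum>i\<in>I. L (f i))"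
proof -
  have "L (0 *\<^sub>C 0) = 0 * L 0"
    using assms(1) zero_mem unfolding bounded_functional_def by blast
  then have "L 0 = 0" by simp
  then show ?thesis using assms(2)
    by (induction I rule: infinite_finite_induct)
      (use assms(1) in \<open>auto simp: bounded_functional_def sum_mem\<close>)
qed

lemma bounded_functional_tendsto:
  assumes L: "bounded_functional H L" and X: "\<And>k. X k \<in> carrier H" and x: "x \<in> carrier H"
    and lim: "(\<lambda>k. hnorm H (X k - x)) \<longlonglongrightarrow> 0"
  shows "(\<lambda>k. L (X k)) \<longlonglongrightarrow> L x"
proof -
  obtain C where C: "\<And>x. x \<in> carrier H \<Longrightarrow> cmod (L x) \<le> C * hnorm H x"
    using L unfolding bounded_functional_def by blast
  have "L (X k - x) = L (X k) - L x" for k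
  proof -
    have "L (X k - x + x) = L (X k - x) + L x"
      using L X x diff_mem unfolding bounded_functional_def by blast
    then show ?thesis by simp
  qed
  then have "cmod (L (X k) - L x) \<le> C * hnorm H (X k - x)" for k
    using C[of "X k - x"] X x diff_mem by simp
  moreover have "(\<lambda>k. C * hnorm H (X k - x)) \<longlonglongrightarrow> 0"
    using tendsto_mult[OF tendsto_const lim, of C] by simp
  ultimately have "(\<lambda>k. L (X k) - L x) \<longlonglongrightarrow> 0"
    by - (rule Lim_null_comparison[OF always_eventually], simp_all)
  then show ?thesis by (simp add: LIM_zero_iff)
qed

end

section \<open>Orthogonal bases\<close>

locale orthogonal_basis = complex_hilbert_space H
  for H :: "'v::complex_vector inner_space" +
  fixes e :: "nat \<Rightarrow> 'v" and v :: "nat \<Rightarrow> real"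
  assumes basis_mem: "e N \<in> carrier H"
    and basis_inner: "ip H (e M) (e N) = (if M = N then of_real (v N) else 0)"
    and weight_pos: "v N > 0"
    and total: "\<lbrakk>f \<in> carrier H; \<And>N. ip H f (e N) = 0\<rbrakk> \<Longrightarrow> f = 0"
begin

definition proj :: "'v \<Rightarrow> nat set \<Rightarrow> 'v"
  where "proj f I = (\<Sum>N\<in>I. (ip H f (e N) / of_real (v N)) *\<^sub>C e N)"

lemma comb_mem: "(\<Sum>N\<in>I. c N *\<^sub>C e N) \<in> carrier H"
  by (intro mem_intros basis_mem)

lemma inner_comb:
  "finite I \<Longrightarrow> ip H (\<Sum>N\<in>I. c N *\<^sub>C e N) (e M) = (if M \<in> I then c M * of_real (v M) else 0)"
  by (simp add: inner_sum_left scaleC_mem basis_mem inner_scaleC_left basis_inner if_distrib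
      cong: if_cong)

lemma hnorm_comb:
  assumes "finite I"
  shows "(hnorm H (\<Sum>N\<in>I. c N *\<^sub>C e N))\<^sup>2 = (\<Sum>N\<in>I. (cmod (c N))\<^sup>2 * v N)"
proof -
  have "ip H (\<Sum>N\<in>I. c N *\<^sub>C e N) (\<Sum>N\<in>I. c N *\<^sub>C e N) =
      (\<Sum>M\<in>I. cnj (c M) * ip H (\<Sum>N\<in>I. c N *\<^sub>C e N) (e M))"
    by (subst inner_sum_right) (auto simp: comb_mem inner_scaleC_right basis_mem scaleC_mem)
  also have "\<dots> = (\<Sum>M\<in>I. of_real ((cmod (c M))\<^sup>2 * v M))"
    using assms by (intro sum.cong) (simp_all add: inner_comb complex_norm_square mult.commute del: of_real_power)
  finally show ?thesis by (simp add: hnorm_sq comb_mem)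
qed

lemma hnorm_proj:
  assumes "finite I"
  shows "(hnorm H (proj f I))\<^sup>2 = (\<Sum>N\<in>I. (cmod (ip H f (e N)))\<^sup>2 / v N)"
  unfolding proj_def hnorm_comb[OF assms]
  by (intro sum.cong refl) (use weight_pos in \<open>auto simp: norm_divide power2_eq_square field_simps\<close>)

lemma Bessel:
  assumes "finite I" and f: "f \<in> carrier H"
  shows "(\<Sum>N\<in>I. (cmod (ip H f (e N)))\<^sup>2 / v N) \<le> (hnorm H f)\<^sup>2"
proof -
  let ?S = "\<Sum>N\<in>I. (cmod (ip H f (e N)))\<^sup>2 / v N"
  have p: "proj f I \<in> carrier H" unfolding proj_def by (rule comb_mem)
  have "ip H f (proj f I) = (\<Sum>N\<in>I. cnj (ip H f (e N) / of_real (v N)) * ip H f (e N))"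
    unfolding proj_def using f by (simp add: inner_sum_right scaleC_mem basis_mem inner_scaleC_right)
  also have "\<dots> = of_real ?S"
    by (simp add: complex_norm_square mult.commute del: of_real_power)
  finally have 1: "ip H f (proj f I) = of_real ?S" .
  have "cmod (ip H f (proj f I)) \<le> hnorm H f * hnorm H (proj f I)"
    by (rule Cauchy_Schwarz[OF f p])
  then have "?S \<le> hnorm H f * hnorm H (proj f I)" unfolding 1 norm_of_real by linarith
  then have "(hnorm H (proj f I))\<^sup>2 \<le> hnorm H f * hnorm H (proj f I)"
    by (simp add: hnorm_proj assms)
  then have "hnorm H (proj f I) \<le> hnorm H f"
    using p f by (cases "hnorm H (proj f I) = 0") (auto simp: power2_eq_square order_less_le)
  then have "(hnorm H (proj f I))\<^sup>2 \<le> (hnorm H f)\<^sup>2"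
    using p by (intro power_mono) auto
  then show ?thesis by (simp add: hnorm_proj assms)
qed

text \<open>
  Bessel's inequality makes the partial sums a Cauchy sequence; their limit has the same inner
  products with the basis as \<open>f\<close> and is therefore \<open>f\<close>.
\<close>

lemma basis_expansion:
  assumes f: "f \<in> carrier H"
  shows "(\<lambda>P. hnorm H (proj f {..<P} - f)) \<longlonglongrightarrow> 0"
proof -
  define t where "t N = (cmod (ip H f (e N)))\<^sup>2 / v N" for N
  have t0: "t N \<ge> 0" for N using weight_pos[of N] by (simp add: t_def)
  have "summable t"
    by (rule bounded_imp_summable[where B = "(hnorm H f)\<^sup>2"])
      (use t0 Bessel[OF _ f] in \<open>auto simp: t_def\<close>)
  then have Cau: "\<exists>N. \<forall>m\<ge>N. \<forall>n. norm (sum t {m..<n}) < \<epsilon>" if "\<epsilon> > 0" for \<epsilon>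
    using that unfolding summable_Cauchy by blast
  have pm: "proj f I \<in> carrier H" for I unfolding proj_def by (rule comb_mem)
  have diff: "proj f {..<k} - proj f {..<j} = proj f {j..<k}" if "j \<le> k" for j k
    unfolding proj_def lessThan_atLeast0 using that by (intro sum_diff_nat_ivl) auto
  have small: "\<exists>N. \<forall>j\<ge>N. \<forall>k\<ge>j. hnorm H (proj f {..<k} - proj f {..<j}) < \<epsilon>" if "\<epsilon> > 0" for \<epsilon>
  proof -
    from Cau[of "\<epsilon>\<^sup>2"] that obtain N where N: "\<And>m n. m \<ge> N \<Longrightarrow> norm (sum t {m..<n}) < \<epsilon>\<^sup>2" by auto
    have "hnorm H (proj f {..<k} - proj f {..<j}) < \<epsilon>" if jk: "j \<ge> N" "k \<ge> j" for j k
    proof -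
      have "(hnorm H (proj f {..<k} - proj f {..<j}))\<^sup>2 = sum t {j..<k}"
        using jk by (simp add: diff hnorm_proj t_def)
      also have "\<dots> < \<epsilon>\<^sup>2" using N[OF jk(1), of k] by simp
      finally show ?thesis
        by (rule power_less_imp_less_base) (use \<open>\<epsilon> > 0\<close> in simp)
    qed
    then show ?thesis by blast
  qed
  have "\<exists>g\<in>carrier H. (\<lambda>k. hnorm H (proj f {..<k} - g)) \<longlonglongrightarrow> 0"
    by (rule complete_ordered[OF pm small])
  then obtain g where g: "g \<in> carrier H" and lim: "(\<lambda>k. hnorm H (proj f {..<k} - g)) \<longlonglongrightarrow> 0"
    by blast
  have "ip H g (e N) = ip H f (e N)" for N
  proof -
    have "(\<lambda>k. ip H (proj f {..<k}) (e N)) \<longlonglongrightarrow> ip H g (e N)"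
      by (rule bounded_functional_tendsto[OF bounded_functional_inner[OF basis_mem] pm g lim])
    moreover have "\<forall>\<^sub>F k in sequentially. ip H (proj f {..<k}) (e N) = ip H f (e N)"
      using eventually_gt_at_top[of N]
    proof eventually_elim
      case (elim k)
      then show ?case using weight_pos[of N] by (simp add: proj_def inner_comb)
    qed
    ultimately show ?thesis
      by (metis LIMSEQ_unique tendsto_eventually)
  qed
  then have "g - f = 0"
    by (intro total diff_mem g f) (simp add: inner_diff_left g f basis_mem)
  then show ?thesis using lim by simp
qed

lemma hnorm_sq_le:
  assumes f: "f \<in> carrier H" and le: "\<And>P. (\<Sum>N<P. (cmod (ip H f (e N)))\<^sup>2 / v N) \<le> C"
  shows "(hnorm H f)\<^sup>2 \<le> C"
proof -
  have pm: "proj f I \<in> carrier H" for I unfolding proj_def by (rule comb_mem)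
  have C0: "C \<ge> 0" using le[of 0] by simp
  have p: "hnorm H (proj f {..<P}) \<le> sqrt C" for P
    using le[of P] hnorm_proj[of "{..<P}" f] by (intro real_le_rsqrt) simp
  have "hnorm H f \<le> hnorm H (proj f {..<P} - f) + sqrt C" for P
  proof -
    have "f = proj f {..<P} + (-1) *\<^sub>C (proj f {..<P} - f)"
      by (simp add: scaleC_minus_one)
    then have "hnorm H f \<le> hnorm H (proj f {..<P}) + hnorm H ((-1) *\<^sub>C (proj f {..<P} - f))"
      by (metis hnorm_triangle pm scaleC_mem diff_mem f)
    then show ?thesis using p[of P] by (simp add: hnorm_scaleC diff_mem pm f)
  qed
  moreover have "(\<lambda>P. hnorm H (proj f {..<P} - f) + sqrt C) \<longlonglongrightarrow> 0 + sqrt C"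
    by (intro tendsto_add basis_expansion f tendsto_const)
  ultimately have "hnorm H f \<le> 0 + sqrt C"
    by (intro LIMSEQ_le_const) auto
  then have "(hnorm H f)\<^sup>2 \<le> (sqrt C)\<^sup>2" using f by (intro power_mono) auto
  then show ?thesis using C0 by simp
qed

lemma functional_eqI:
  assumes L: "bounded_functional H L" and L': "bounded_functional H L'"
    and eq: "\<And>N. L (e N) = L' (e N)" and f: "f \<in> carrier H"
  shows "L f = L' f"
proof -
  have pm: "proj f I \<in> carrier H" for I unfolding proj_def by (rule comb_mem)
  have "L (c *\<^sub>C e N) = L' (c *\<^sub>C e N)" for c N
    using L L' eq basis_mem by (simp add: bounded_functional_def)
  then have "L (proj f {..<P}) = L' (proj f {..<P})" for P
    unfolding proj_def
    by (simp add: bounded_functional_sum[OF L] bounded_functional_sum[OF L'] scaleC_mem basis_mem)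
  moreover have "(\<lambda>P. L (proj f {..<P})) \<longlonglongrightarrow> L f" "(\<lambda>P. L' (proj f {..<P})) \<longlonglongrightarrow> L' f"
    by (intro bounded_functional_tendsto L L' pm f basis_expansion)+
  ultimately show ?thesis by (simp add: LIMSEQ_unique)
qed

end

section \<open>Monomials in the weighted spaces\<close>

text \<open>
  The Taylor coefficients of \<open>(1 - x)\<^sup>-\<^sup>l\<close>; their reciprocals turn out to be the squared norms of the
  monomials.
\<close>

definition kernel_coeff :: "real \<Rightarrow> nat \<Rightarrow> real"
  where "kernel_coeff l N = pochhammer l N / fact N"

text \<open>
  Elements of the weighted spaces vanish off the disc, so monomials are truncated likewise.
\<close>

definition disc_monom :: "nat \<Rightarrow> complex \<Rightarrow> complex"
  where "disc_monom N = (\<lambda>z. if z \<in> ball 0 1 then z ^ N else 0)"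

text \<open>
  The falling factorial \<open>x (x - 1) \<dots> (x - r + 1)\<close>, the factor that \<open>r\<close>-fold differentiation of
  \<open>z\<^sup>x\<close> produces.  Its argument is complex because it is also read as a polynomial in \<open>x\<close>.
\<close>

definition falling :: "nat \<Rightarrow> complex \<Rightarrow> complex"
  where "falling r x = (\<Prod>s<r. x - of_nat s)"

lemma kernel_coeff_pos: "l > 0 \<Longrightarrow> kernel_coeff l N > 0"
  by (simp add: kernel_coeff_def pochhammer_pos)

text \<open>
  Consecutive coefficients have ratio \<open>(l + Q) / (Q + 1)\<close>, which Bernoulli's inequality bounds by
  \<open>((Q + 2) / (Q + 1))\<^sup>m\<close>; the product telescopes.  Hence over indices of comparable size the
  coefficients grow at most by a constant factor.
\<close>

lemma kernel_coeff_growth: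
  assumes l: "l > 0" "l \<le> real m" and "P \<le> P'"
  shows "kernel_coeff l P' \<le> kernel_coeff l P * ((real P' + 1) / (real P + 1)) ^ m"
  using \<open>P \<le> P'\<close>
proof (induction P' rule: dec_induct)
  case (step Q)
  have "(l + real Q) / (real Q + 1) \<le> 1 + real m * (1 / (real Q + 1))"
  proof -
    have "1 + real m * (1 / (real Q + 1)) = (real Q + 1 + real m) / (real Q + 1)"
      by (simp add: field_simps)
    then show ?thesis using l by (simp add: divide_right_mono)
  qed
  also have "\<dots> \<le> (1 + 1 / (real Q + 1)) ^ m"
    by (rule Bernoulli_inequality) (simp add: divide_nonneg_nonneg order_trans[of _ 0])
  also have "1 + 1 / (real Q + 1) = (real (Suc Q) + 1) / (real Q + 1)"
    by (simp add: field_simps)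
  finally have r: "(l + real Q) / (real Q + 1) \<le> ((real (Suc Q) + 1) / (real Q + 1)) ^ m" .
  have "kernel_coeff l (Suc Q) = kernel_coeff l Q * ((l + real Q) / (real Q + 1))"
    by (simp add: kernel_coeff_def pochhammer_Suc add.commute)
  also have "\<dots> \<le> (kernel_coeff l P * ((real Q + 1) / (real P + 1)) ^ m) *
      ((real (Suc Q) + 1) / (real Q + 1)) ^ m"
    using l kernel_coeff_pos[of l] by (intro mult_mono step.IH r) (auto intro: less_imp_le)
  also have "\<dots> = kernel_coeff l P * (((real Q + 1) / (real P + 1)) * ((real (Suc Q) + 1) / (real Q + 1))) ^ m"
    by (simp only: power_mult_distrib mult.assoc)
  also have "((real Q + 1) / (real P + 1)) * ((real (Suc Q) + 1) / (real Q + 1)) = (real (Suc Q) + 1) / (real P + 1)"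
  proof -
    have "real Q + 1 \<noteq> 0" by linarith
    then show ?thesis by (simp del: of_nat_Suc)
  qed
  finally show ?case .
qed simp

lemma kernel_series:
  assumes "cmod x < 1"
  shows "(\<lambda>N. of_real (kernel_coeff l N) * x ^ N) sums (1 - x) powr (- of_real l)"
proof -
  have "(\<lambda>N. (- of_real l gchoose N) * (- x) ^ N) sums (1 + (- x)) powr (- of_real l)"
    by (rule gen_binomial_complex) (use assms in simp)
  moreover have "(- of_real l gchoose N) * (- x) ^ N = of_real (kernel_coeff l N) * x ^ N" for N
  proof -
    have "(- x) ^ N = (-1) ^ N * x ^ N" by (metis mult_minus1 power_mult_distrib)
    moreover have "(-1 :: complex) ^ N * (-1) ^ N = 1" by (simp flip: power_add)
    moreover have "pochhammer (complex_of_real l) N = of_real (pochhammer l N)"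
      by (simp add: pochhammer_of_real)
    ultimately show ?thesis by (simp add: gbinomial_pochhammer kernel_coeff_def)
  qed
  ultimately show ?thesis by simp
qed

lemma falling_fact: "falling r (of_nat (Q + r)) = fact (Q + r) / fact Q"
proof (induction r arbitrary: Q)
  case (Suc r)
  have "falling (Suc r) (of_nat (Q + Suc r)) = falling r (of_nat (Suc Q + r)) * (of_nat Q + 1)"
    by (simp add: falling_def)
  moreover have "fact (Suc Q) = (of_nat Q + 1) * (fact Q :: complex)"
    by (simp add: add.commute)
  moreover have "(of_nat Q + 1 :: complex) \<noteq> 0"
    using of_nat_neq_0[of Q, where 'a = complex] by (simp add: add.commute)
  ultimately show ?case unfolding Suc by (simp del: fact_Suc)
qed (simp add: falling_def)

lemma falling_eq_0: "N < r \<Longrightarrow> falling r (of_nat N) = 0"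
  by (auto simp: falling_def)

lemma powser_unique:
  fixes a b :: "nat \<Rightarrow> complex"
  assumes r: "r > 0"
    and a: "\<And>w. cmod w < r \<Longrightarrow> (\<lambda>n. a n * w ^ n) sums f w"
    and b: "\<And>w. cmod w < r \<Longrightarrow> (\<lambda>n. b n * w ^ n) sums f w"
  shows "a n = b n"
proof (rule ccontr)
  assume n: "a n \<noteq> b n"
  have s: "(\<lambda>n. (a n - b n) * (w - 0) ^ n) sums 0" if "cmod (w - 0) < r" for w
    using sums_diff[OF a b, of w w] that by (simp add: algebra_simps)
  have "a 0 - b 0 = 0" using s[of 0] r by simp
  with n have "n > 0" by (cases n) auto
  have "a n - b n \<noteq> 0" using n by simp
  have "\<exists>s>0. \<forall>z\<in>cball (0::complex) s - {0}. (0 :: complex) \<noteq> 0"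
  proof (rule powser_0_nonzero[of r 0 "\<lambda>n. a n - b n" "\<lambda>_. 0" n])
    show "(\<lambda>n. (a n - b n) * (w - 0) ^ n) sums 0" if "cmod (w - 0) < r" for w
      using that by (rule s)
    fix s :: real assume s: "0 < s" "\<And>z. z \<in> cball (0::complex) s - {0} \<Longrightarrow> (0 :: complex) \<noteq> 0"
    show "\<exists>s>0. \<forall>z\<in>cball (0::complex) s - {0}. (0 :: complex) \<noteq> 0"
      by (intro exI[of _ s] conjI ballI s(1)) (erule s(2))
  next
    show "a n - b n \<noteq> 0" by fact
  qed (use r \<open>n > 0\<close> in simp_all)
  then obtain s where "0 < s" and s0: "\<And>z. z \<in> cball (0::complex) s - {0} \<Longrightarrow> (0 :: complex) \<noteq> 0"
    by blast
  have "of_real s \<in> cball (0 :: complex) s - {0}" using \<open>0 < s\<close> by simp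
  from s0[OF this] show False by simp
qed

lemma Re_one_minus_mult_pos:
  assumes "cmod v < 1" "cmod u < 1"
  shows "Re (1 - v * u) > 0"
proof -
  have "cmod (v * u) < 1" using assms by (metis mult_strict_mono' norm_ge_zero norm_mult mult_1)
  then show ?thesis using complex_Re_le_cmod[of "v * u"] by simp
qed

lemma higher_deriv_kernel:
  assumes v: "cmod v < 1" and u: "cmod u < 1"
  shows "(deriv ^^ r) (\<lambda>u. (1 - v * u) powr (- of_real l)) u =
    of_real (pochhammer l r) * v ^ r * (1 - v * u) powr (- of_real (l + r))"
  using u
proof (induction r arbitrary: u)
  case (Suc r)
  let ?g = "\<lambda>u. of_real (pochhammer l r) * v ^ r * (1 - v * u) powr (- of_real (l + r))"
  have nz: "1 - v * u \<notin> \<real>\<^sub>\<le>\<^sub>0"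
    using Re_one_minus_mult_pos[OF v Suc.prems] by (auto simp: complex_nonpos_Reals_iff)
  have "(?g has_field_derivative
      of_real (pochhammer l r) * v ^ r * ((- of_real (l + r)) * (1 - v * u) powr (- of_real (l + r) - 1) * (- v))) (at u)"
    by (rule derivative_eq_intros nz refl | simp)+
  moreover have "of_real (pochhammer l r) * v ^ r * ((- of_real (l + r)) * (1 - v * u) powr (- of_real (l + r) - 1) * (- v))
     = of_real (pochhammer l (Suc r)) * v ^ Suc r * (1 - v * u) powr (- of_real (l + Suc r))"
  proof -
    have "- complex_of_real (l + r) - 1 = - of_real (l + Suc r)" by simp
    moreover have "of_real (pochhammer l r) * v ^ r * ((- of_real (l + r)) * X * (- v))
        = of_real (pochhammer l (Suc r)) * v ^ Suc r * X" for X
      by (simp add: pochhammer_Suc algebra_simps)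
    ultimately show ?thesis by presburger
  qed
  ultimately have g: "(?g has_field_derivative of_real (pochhammer l (Suc r)) * v ^ Suc r *
      (1 - v * u) powr (- of_real (l + Suc r))) (at u)"
    by simp
  have "((deriv ^^ r) (\<lambda>u. (1 - v * u) powr (- of_real l)) has_field_derivative
      of_real (pochhammer l (Suc r)) * v ^ Suc r * (1 - v * u) powr (- of_real (l + Suc r))) (at u)"
    by (rule has_field_derivative_transform_within_open[OF g, of "ball 0 1"])
      (use Suc in auto)
  then show ?case by (simp add: DERIV_imp_deriv)
qed simp

lemma dbar_kernel_eq:
  assumes v: "cmod v < 1" and w: "cmod w < 1"
  shows "dbar_kernel r l w v =
    of_real (pochhammer l r) * v ^ r * (1 - v * cnj w) powr (- of_real (l + r))"
  using higher_deriv_kernel[OF v, of "cnj w" r l] v w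
  by (simp add: dbar_kernel_def dbar_def disc_kernel_def)

text \<open>
  Boundedness of multiplication by \<open>z\<close> puts the monomials into the space: they arise from the
  constant \<open>1 = K(\<cdot>, 0)\<close>.
\<close>

locale weighted_space = complex_hilbert_space H
  for H :: "(complex \<Rightarrow> complex) inner_space" and l :: real +
  assumes parameter_pos: "l > 0" and weighted: "is_weighted_space l H"
    and shift: "bounded_operator H H mult_z"
begin

lemma kernel_mem: "cmod w < 1 \<Longrightarrow> disc_kernel l w \<in> carrier H"
  and reproducing: "cmod w < 1 \<Longrightarrow> f \<in> carrier H \<Longrightarrow> ip H f (disc_kernel l w) = f w"
  and holomorphic: "f \<in> carrier H \<Longrightarrow> f holomorphic_on ball 0 1"
  and outside_disc: "f \<in> carrier H \<Longrightarrow> z \<notin> ball 0 1 \<Longrightarrow> f z = 0"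
  using weighted unfolding is_weighted_space_def by auto

lemma fun_eqI: "\<lbrakk>f \<in> carrier H; g \<in> carrier H; \<And>z. cmod z < 1 \<Longrightarrow> f z = g z\<rbrakk> \<Longrightarrow> f = g"
  using outside_disc[of f] outside_disc[of g] by (fastforce simp: fun_eq_iff)

lemma kernel_zero: "disc_kernel l 0 = disc_monom 0"
  by (auto simp: disc_kernel_def disc_monom_def fun_eq_iff)

lemma mult_z_monom: "mult_z (disc_monom N) = disc_monom (Suc N)"
  by (auto simp: mult_z_def disc_monom_def fun_eq_iff)

lemma monom_mem: "disc_monom N \<in> carrier H"
proof (induction N)
  case 0
  then show ?case using kernel_mem[of 0] by (simp add: kernel_zero)
next
  case (Suc N)
  then show ?case using shift unfolding bounded_operator_def mult_z_monom[symmetric] by blast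
qed

lemma monom_apply: "cmod z < 1 \<Longrightarrow> disc_monom N z = z ^ N"
  by (simp add: disc_monom_def)

lemma monom_growth: "\<exists>C\<ge>1. \<forall>N. hnorm H (disc_monom N) \<le> C ^ N * hnorm H (disc_monom 0)"
proof -
  obtain C where C: "\<And>f. f \<in> carrier H \<Longrightarrow> hnorm H (mult_z f) \<le> C * hnorm H f"
    using shift unfolding bounded_operator_def by blast
  let ?C = "max 1 C"
  have "hnorm H (disc_monom N) \<le> ?C ^ N * hnorm H (disc_monom 0)" for N
  proof (induction N)
    case (Suc N)
    have "hnorm H (disc_monom (Suc N)) \<le> C * hnorm H (disc_monom N)"
      using C[OF monom_mem] by (simp add: mult_z_monom)
    also have "\<dots> \<le> ?C * hnorm H (disc_monom N)"
      by (intro mult_right_mono) (auto simp: monom_mem)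
    also have "\<dots> \<le> ?C * (?C ^ N * hnorm H (disc_monom 0))"
      by (intro mult_left_mono Suc) auto
    finally show ?case by (simp add: mult.assoc)
  qed simp
  then show ?thesis by (intro exI[of _ ?C]) auto
qed

text \<open>
  The norms of the monomials grow at most geometrically, as multiplication by \<open>z\<close> is bounded.  So
  for small \<open>w\<close> the power series of the kernel function at \<open>w\<close> converges absolutely in the Hilbert
  space; point evaluations identify its limit, and bounded functionals may be applied termwise.
\<close>

lemma kernel_expansion:
  obtains \<rho> where "0 < \<rho>" "\<rho> \<le> 1"
    "\<And>w L. cmod w < \<rho> \<Longrightarrow> bounded_functional H L \<Longrightarrow>
      (\<lambda>N. of_real (kernel_coeff l N) * cnj w ^ N * L (disc_monom N)) sums L (disc_kernel l w)"
proof -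
  obtain C where C1: "C \<ge> 1"
    and C: "\<And>N. hnorm H (disc_monom N) \<le> C ^ N * hnorm H (disc_monom 0)"
    using monom_growth by blast
  show thesis
  proof (rule that[of "1 / C"])
    show "0 < 1 / C" "1 / C \<le> 1" using C1 by auto
    fix w :: complex and L assume w: "cmod w < 1 / C" and L: "bounded_functional H L"
    have w1: "cmod w < 1" using w C1 by (smt (verit) divide_le_eq_1)
    define x where "x N = (of_real (kernel_coeff l N) * cnj w ^ N) *\<^sub>C disc_monom N" for N
    have x: "x N \<in> carrier H" for N unfolding x_def by (intro scaleC_mem monom_mem)
    define b where "b N = kernel_coeff l N * (cmod w * C) ^ N * hnorm H (disc_monom 0)" for N
    have xb: "hnorm H (x N) \<le> b N" for N
    proof -
      have k: "kernel_coeff l N > 0" by (rule kernel_coeff_pos[OF parameter_pos])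
      have "hnorm H (x N) = kernel_coeff l N * cmod w ^ N * hnorm H (disc_monom N)"
        using k by (simp add: x_def hnorm_scaleC monom_mem norm_mult norm_power)
      also have "\<dots> \<le> kernel_coeff l N * cmod w ^ N * (C ^ N * hnorm H (disc_monom 0))"
        using k by (intro mult_left_mono C) auto
      finally show ?thesis by (simp add: b_def power_mult_distrib mult_ac)
    qed
    have "cmod (of_real (cmod w * C)) < 1" using w C1 by (simp add: norm_mult field_simps)
    from sums_Re[OF kernel_series[OF this, of l]]
    have "summable (\<lambda>N. kernel_coeff l N * (cmod w * C) ^ N)"
      by (simp add: sums_iff flip: of_real_power of_real_mult)
    then have sb: "summable b" unfolding b_def by (rule summable_mult2)
    obtain s where s: "s \<in> carrier H" and lim: "(\<lambda>P. hnorm H ((\<Sum>N<P. x N) - s)) \<longlonglongrightarrow> 0"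
      using abs_summable_convergent[OF x xb sb] by blast
    have sm: "(\<Sum>N<P. x N) \<in> carrier H" for P by (intro sum_mem x)
    have Lx: "(\<lambda>N. L' (x N)) sums L' s" if L': "bounded_functional H L'" for L'
      using bounded_functional_tendsto[OF L' sm s lim]
      by (simp add: sums_def bounded_functional_sum[OF L' x])
    have "s = disc_kernel l w"
    proof (rule fun_eqI[OF s kernel_mem[OF w1]])
      fix z :: complex assume z: "cmod z < 1"
      have "(\<lambda>N. ip H (x N) (disc_kernel l z)) sums ip H s (disc_kernel l z)"
        by (rule Lx[OF bounded_functional_inner[OF kernel_mem[OF z]]])
      then have 1: "(\<lambda>N. x N z) sums s z"
        by (simp add: reproducing[OF z] x s)
      have "cmod (z * cnj w) < 1"
        using z w1 by (metis complex_mod_cnj mult_strict_mono' norm_ge_zero norm_mult mult_1)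
      from kernel_series[OF this, of l] have "(\<lambda>N. x N z) sums disc_kernel l w z"
        using z by (simp add: x_def scaleC_apply scaleC_complex_def monom_apply disc_kernel_def
            power_mult_distrib mult_ac)
      with 1 show "s z = disc_kernel l w z" by (rule sums_unique2)
    qed
    moreover have "L (x N) = of_real (kernel_coeff l N) * cnj w ^ N * L (disc_monom N)" for N
      using L monom_mem unfolding x_def bounded_functional_def by blast
    ultimately show "(\<lambda>N. of_real (kernel_coeff l N) * cnj w ^ N * L (disc_monom N)) sums L (disc_kernel l w)"
      using Lx[OF L] by simp
  qed
qed

text \<open>
  Pairing \<open>f\<close> with the expanded kernel function shows that the inner products with the monomials
  are the rescaled Taylor coefficients of \<open>f\<close>.  The conjugations make the series a holomorphic one
  in \<open>u = cnj w\<close>.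
\<close>

lemma taylor_coefficients:
  obtains \<rho> where "0 < \<rho>" "\<rho> \<le> 1" "\<And>f u. f \<in> carrier H \<Longrightarrow> cmod u < \<rho> \<Longrightarrow>
    (\<lambda>N. of_real (kernel_coeff l N) * ip H (disc_monom N) f * u ^ N) sums cnj (f (cnj u))"
proof -
  obtain \<rho> where \<rho>: "0 < \<rho>" "\<rho> \<le> 1" and ex: "\<And>w L. cmod w < \<rho> \<Longrightarrow> bounded_functional H L \<Longrightarrow>
      (\<lambda>N. of_real (kernel_coeff l N) * cnj w ^ N * L (disc_monom N)) sums L (disc_kernel l w)"
    using kernel_expansion by blast
  show thesis
  proof (rule that[OF \<rho>])
    fix f and u :: complex assume f: "f \<in> carrier H" and u: "cmod u < \<rho>"
    have u1: "cmod (cnj u) < 1" using u \<rho> by simp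
    have "ip H (disc_kernel l (cnj u)) f = cnj (f (cnj u))"
      using inner_commute[OF f kernel_mem[OF u1]] reproducing[OF u1 f] by simp
    then show "(\<lambda>N. of_real (kernel_coeff l N) * ip H (disc_monom N) f * u ^ N) sums cnj (f (cnj u))"
      using ex[OF _ bounded_functional_inner[OF f], of "cnj u"] u by (simp add: mult_ac)
  qed
qed

text \<open>
  The Taylor series of \<open>z\<^sup>N\<close> is known, which determines the Gram matrix of the monomials.  A function
  orthogonal to all monomials has zero Taylor series at the origin and so vanishes on the disc.
\<close>

sublocale orthogonal_basis H disc_monom "\<lambda>N. 1 / kernel_coeff l N"
proof
  obtain \<rho> where \<rho>: "0 < \<rho>" "\<rho> \<le> 1" and tc: "\<And>f u. f \<in> carrier H \<Longrightarrow> cmod u < \<rho> \<Longrightarrow>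
    (\<lambda>N. of_real (kernel_coeff l N) * ip H (disc_monom N) f * u ^ N) sums cnj (f (cnj u))"
    using taylor_coefficients by blast
  have kp: "kernel_coeff l N > 0" for N by (rule kernel_coeff_pos[OF parameter_pos])
  show "disc_monom N \<in> carrier H" for N by (rule monom_mem)
  show "1 / kernel_coeff l N > 0" for N using kp by simp
  show "ip H (disc_monom M) (disc_monom N) = (if M = N then of_real (1 / kernel_coeff l N) else 0)"
    for M N
  proof -
    have "of_real (kernel_coeff l M) * ip H (disc_monom M) (disc_monom N) = (if M = N then 1 else 0)"
    proof (rule powser_unique[OF \<rho>(1), where n = M
          and a = "\<lambda>M. of_real (kernel_coeff l M) * ip H (disc_monom M) (disc_monom N)"
          and b = "\<lambda>M. if M = N then 1 else 0"])
      fix u :: complex assume u: "cmod u < \<rho>"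
      then have "cmod u < 1" using \<rho> by simp
      then show "(\<lambda>M. of_real (kernel_coeff l M) * ip H (disc_monom M) (disc_monom N) * u ^ M) sums u ^ N"
        using tc[OF monom_mem u] by (simp add: monom_apply)
      show "(\<lambda>M. (if M = N then 1 else 0) * u ^ M) sums u ^ N"
        using sums_single[of N "\<lambda>M. u ^ M"] by (simp add: if_distrib if_distribR cong: if_cong)
    qed
    then show ?thesis using kp[of M] kp[of N] by (auto simp: field_simps split: if_splits)
  qed
  fix f assume f: "f \<in> carrier H" and z: "\<And>N. ip H f (disc_monom N) = 0"
  have z': "ip H (disc_monom N) f = 0" for N
    using inner_commute[OF f monom_mem] z by simp
  have f0: "f w = 0" if "w \<in> ball 0 \<rho>" for w
  proof -
    have "(\<lambda>N. 0) sums cnj (f w)" using tc[OF f, of "cnj w"] that by (simp add: z')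
    then show ?thesis by (simp add: sums_iff)
  qed
  show "f = 0"
  proof (rule fun_eqI[OF f zero_mem])
    fix w :: complex assume "cmod w < 1"
    have "f w = (\<lambda>_. 0) w"
      by (rule analytic_continuation_open[of "ball 0 \<rho>" "ball 0 1"])
        (use \<rho> f0 holomorphic[OF f] \<open>cmod w < 1\<close> in auto)
    then show "f w = 0 w" by simp
  qed
qed

lemma adjoint_shift_coefficient:
  assumes A: "is_adjoint H mult_z A" and f: "f \<in> carrier H"
  shows "ip H (A f) (disc_monom N) = ip H f (disc_monom (Suc N))"
proof -
  have Af: "A f \<in> carrier H" using A f unfolding is_adjoint_def bounded_operator_def by blast
  have "ip H (mult_z (disc_monom N)) f = ip H (disc_monom N) (A f)"
    using A f monom_mem unfolding is_adjoint_def by blast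
  then have "ip H (disc_monom (Suc N)) f = ip H (disc_monom N) (A f)"
    by (simp only: mult_z_monom)
  then show ?thesis
    using inner_commute[OF monom_mem f, of "Suc N"] inner_commute[OF monom_mem Af, of N] by simp
qed

end

lemma bounded_functional_compose:
  assumes "bounded_operator H1 H2 A" "complex_hilbert_space H2" "y \<in> carrier H2"
  shows "bounded_functional H1 (\<lambda>x. ip H2 (A x) y)"
proof -
  interpret H2: complex_hilbert_space H2 by fact
  obtain C where A: "\<And>x. x \<in> carrier H1 \<Longrightarrow> A x \<in> carrier H2"
      "\<And>x y. x \<in> carrier H1 \<Longrightarrow> y \<in> carrier H1 \<Longrightarrow> A (x + y) = A x + A y"
      "\<And>a x. x \<in> carrier H1 \<Longrightarrow> A (a *\<^sub>C x) = a *\<^sub>C A x"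
    and C: "\<And>x. x \<in> carrier H1 \<Longrightarrow> hnorm H2 (A x) \<le> C * hnorm H1 x"
    using assms(1) unfolding bounded_operator_def by blast
  have "cmod (ip H2 (A x) y) \<le> (C * hnorm H2 y) * hnorm H1 x" if "x \<in> carrier H1" for x
  proof -
    have "cmod (ip H2 (A x) y) \<le> hnorm H2 (A x) * hnorm H2 y"
      by (rule H2.Cauchy_Schwarz) (use A that assms in auto)
    also have "\<dots> \<le> (C * hnorm H1 x) * hnorm H2 y"
      by (intro mult_right_mono C that) (use assms in auto)
    finally show ?thesis by (simp add: mult_ac)
  qed
  then show ?thesis
    unfolding bounded_functional_def
    using A assms by (auto simp: H2.inner_add_left H2.inner_scaleC_left)
qed

text \<open>
  Comparing powers of \<open>cnj w\<close> in the action of \<open>A\<close> on the expanded kernel function shows that \<open>A\<close>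
  sends \<open>z\<^sup>Q\<close> to a multiple of \<open>z\<^sup>(\<^sup>Q\<^sup>+\<^sup>r\<^sup>)\<close>.  Both sides of the claim are then bounded functionals of \<open>f\<close>
  that agree on monomials.  The formula says that \<open>A\<^sup>*\<close> is \<open>r\<close>-fold differentiation times \<open>cnj m\<close>.
\<close>

lemma kernel_intertwiner_coefficient:
  assumes "weighted_space H1 l1" "weighted_space H2 l2"
    and A: "bounded_operator H1 H2 A"
    and kernel: "\<And>w. cmod w < 1 \<Longrightarrow> A (disc_kernel l1 w) = m *\<^sub>C dbar_kernel r l2 w"
    and f: "f \<in> carrier H1"
  shows "ip H2 (A f) (disc_monom N) =
    m * falling r (of_nat N) * (if r \<le> N then ip H1 f (disc_monom (N - r)) else 0)"
proof -
  interpret H1: weighted_space H1 l1 by fact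
  interpret H2: weighted_space H2 l2 by fact
  have hH2: "complex_hilbert_space H2" ..
  have kp: "kernel_coeff l1 N > 0" "kernel_coeff l2 N > 0" for N
    using kernel_coeff_pos H1.parameter_pos H2.parameter_pos by auto
  have Am: "A g \<in> carrier H2" if "g \<in> carrier H1" for g
    using A that unfolding bounded_operator_def by blast
  obtain \<rho> where \<rho>: "0 < \<rho>" "\<rho> \<le> 1" and ex: "\<And>w L. cmod w < \<rho> \<Longrightarrow> bounded_functional H1 L \<Longrightarrow>
      (\<lambda>N. of_real (kernel_coeff l1 N) * cnj w ^ N * L (disc_monom N)) sums L (disc_kernel l1 w)"
    using H1.kernel_expansion by blast
  \<comment> \<open>the quotient of the coefficients of \<open>cnj w ^ Q\<close> in \<open>m K\<^sub>2\<^sup>(\<^sup>r\<^sup>)(\<cdot>, w)\<close> and in \<open>K\<^sub>1(\<cdot>, w)\<close>\<close>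
  define \<kappa> where "\<kappa> Q = m * of_real (pochhammer l2 r * kernel_coeff (l2 + r) Q / kernel_coeff l1 Q)" for Q
  have AQ: "A (disc_monom Q) = \<kappa> Q *\<^sub>C disc_monom (Q + r)" for Q
  proof (rule H2.fun_eqI)
    show "A (disc_monom Q) \<in> carrier H2" by (intro Am H1.monom_mem)
    show "\<kappa> Q *\<^sub>C disc_monom (Q + r) \<in> carrier H2" by (intro H2.scaleC_mem H2.monom_mem)
    fix v :: complex assume v: "cmod v < 1"
    have "of_real (kernel_coeff l1 Q) * A (disc_monom Q) v =
        m * of_real (pochhammer l2 r) * of_real (kernel_coeff (l2 + r) Q) * v ^ (Q + r)"
    proof (rule powser_unique[OF \<rho>(1), where n = Q
          and a = "\<lambda>Q. of_real (kernel_coeff l1 Q) * A (disc_monom Q) v"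
          and b = "\<lambda>Q. m * of_real (pochhammer l2 r) * of_real (kernel_coeff (l2 + r) Q) * v ^ (Q + r)"])
      fix u :: complex assume u: "cmod u < \<rho>"
      then have u1: "cmod (cnj u) < 1" using \<rho> by simp
      have "A (disc_kernel l1 (cnj u)) v =
          m * (of_real (pochhammer l2 r) * v ^ r * (1 - v * u) powr (- of_real (l2 + r)))"
        using dbar_kernel_eq[OF v u1, of r l2] kernel[OF u1]
        by (simp add: scaleC_apply scaleC_complex_def)
      then show "(\<lambda>Q. of_real (kernel_coeff l1 Q) * A (disc_monom Q) v * u ^ Q) sums
          (m * (of_real (pochhammer l2 r) * v ^ r * (1 - v * u) powr (- of_real (l2 + r))))"
        using ex[OF _ bounded_functional_compose[OF A hH2 H2.kernel_mem[OF v]], of "cnj u"] u u1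
        by (simp add: H2.reproducing[OF v] Am H1.monom_mem H1.kernel_mem mult_ac)
      have "cmod (v * u) < 1"
        using v u1 by (metis complex_mod_cnj mult_strict_mono' norm_ge_zero norm_mult mult_1)
      from sums_mult[OF kernel_series[OF this, of "l2 + r"], of "m * of_real (pochhammer l2 r) * v ^ r"]
      show "(\<lambda>Q. m * of_real (pochhammer l2 r) * of_real (kernel_coeff (l2 + r) Q) * v ^ (Q + r) * u ^ Q) sums
          (m * (of_real (pochhammer l2 r) * v ^ r * (1 - v * u) powr (- of_real (l2 + r))))"
        by (simp add: power_mult_distrib power_add mult_ac)
    qed
    then show "A (disc_monom Q) v = (\<kappa> Q *\<^sub>C disc_monom (Q + r)) v"
      using kp(1)[of Q] v
      by (simp add: scaleC_apply scaleC_complex_def \<kappa>_def field_simps H1.monom_apply)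
  qed
  let ?R = "\<lambda>f. m * falling r (of_nat N) * (if r \<le> N then ip H1 f (disc_monom (N - r)) else 0)"
  show ?thesis
  proof (rule H1.functional_eqI[OF _ _ _ f, of _ ?R])
    show "bounded_functional H1 (\<lambda>f. ip H2 (A f) (disc_monom N))"
      by (rule bounded_functional_compose[OF A hH2 H2.monom_mem])
    show "bounded_functional H1 ?R"
    proof (cases "r \<le> N")
      case True
      have c: "complex_hilbert_space H1" ..
      have "bounded_operator H1 H1 (\<lambda>x. (m * falling r (of_nat N)) *\<^sub>C x)"
        unfolding bounded_operator_def
        by (auto simp: H1.scaleC_mem scaleC_add_right scaleC_scaleC mult.commute H1.hnorm_scaleC
            intro!: exI[of _ "cmod (m * falling r (of_nat N))"])
      from bounded_functional_compose[OF this c H1.monom_mem, of "N - r"] True show ?thesis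
        by (simp add: bounded_functional_def H1.add_mem H1.scaleC_mem
            H1.inner_scaleC_left H1.monom_mem)
    qed (auto simp: bounded_functional_def intro!: exI[of _ 0])
    fix Q
    have "ip H2 (A (disc_monom Q)) (disc_monom N) = \<kappa> Q * (if Q + r = N then of_real (1 / kernel_coeff l2 N) else 0)"
      by (simp add: AQ H2.inner_scaleC_left H2.monom_mem H2.basis_inner)
    also have "\<dots> = ?R (disc_monom Q)"
    proof (cases "Q + r = N")
      case True
      have p: "pochhammer l2 r * pochhammer (l2 + r) Q = pochhammer l2 N"
        using pochhammer_product[of r N l2] True by force
      have l2: "pochhammer l2 N > 0" by (simp add: pochhammer_pos H2.parameter_pos)
      have "pochhammer l2 r * kernel_coeff (l2 + r) Q / kernel_coeff l1 Q * (1 / kernel_coeff l2 N)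
        = (pochhammer l2 r * pochhammer (l2 + r) Q) / pochhammer l2 N * (fact N / fact Q) / kernel_coeff l1 Q"
        by (simp add: kernel_coeff_def field_simps)
      also have "\<dots> = (fact N / fact Q) / kernel_coeff l1 Q"
        using l2 by (simp add: p)
      finally have e: "pochhammer l2 r * kernel_coeff (l2 + r) Q / kernel_coeff l1 Q * (1 / kernel_coeff l2 N)
          = (fact N / fact Q) / kernel_coeff l1 Q" .
      have "\<kappa> Q * of_real (1 / kernel_coeff l2 N) = m * of_real ((fact N / fact Q) / kernel_coeff l1 Q)"
        unfolding e[symmetric] \<kappa>_def by (simp only: of_real_mult mult.assoc)
      also have "\<dots> = ?R (disc_monom Q)"
        using falling_fact[of r Q] True by (auto simp: H1.basis_inner)
      finally show ?thesis using True by simp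
    next
      case False
      then show ?thesis by (cases "r \<le> N") (auto simp: H1.basis_inner)
    qed
    finally show "ip H2 (A (disc_monom Q)) (disc_monom N) = ?R (disc_monom Q)" .
  qed
qed

section \<open>Polynomial sequences\<close>

text \<open>
  Polynomial sequences of degree less than \<open>d\<close>, described by vanishing \<open>d\<close>-fold differences with
  arbitrary steps.  With this description a sequence whose increments are polynomial is polynomial
  for a trivial reason, and step sizes remain free for the averaging argument below.
\<close>

fun poly_below :: "nat \<Rightarrow> (nat \<Rightarrow> complex) \<Rightarrow> bool" where
  "poly_below 0 g \<longleftrightarrow> (\<forall>k. g k = 0)"
| "poly_below (Suc d) g \<longleftrightarrow> (\<forall>h. poly_below d (\<lambda>k. g (k + h) - g k))"

lemma poly_below_zero: "poly_below d (\<lambda>_. 0)"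
  by (induction d) auto

lemma poly_below_add: "poly_below d f \<Longrightarrow> poly_below d g \<Longrightarrow> poly_below d (\<lambda>k. f k + g k)"
proof (induction d arbitrary: f g)
  case (Suc d)
  have "poly_below d (\<lambda>k. (f (k + h) - f k) + (g (k + h) - g k))" for h
    using Suc.prems by (intro Suc.IH) auto
  then show ?case by (simp add: algebra_simps)
qed auto

lemma poly_below_cmult: "poly_below d g \<Longrightarrow> poly_below d (\<lambda>k. c * g k)"
proof (induction d arbitrary: g)
  case (Suc d)
  have "poly_below d (\<lambda>k. c * (g (k + h) - g k))" for h
    using Suc.prems by (intro Suc.IH) auto
  then show ?case by (simp add: algebra_simps)
qed auto

lemma poly_below_sum: "(\<And>i. i \<in> I \<Longrightarrow> poly_below d (f i)) \<Longrightarrow> poly_below d (\<lambda>k. \<Sum>i\<in>I. f i k)"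
  by (induction I rule: infinite_finite_induct) (auto intro: poly_below_zero poly_below_add)

lemma poly_below_Suc: "poly_below d g \<Longrightarrow> poly_below (Suc d) g"
  by (induction d arbitrary: g) auto

lemma poly_below_mono: "poly_below d g \<Longrightarrow> d \<le> d' \<Longrightarrow> poly_below d' g"
  by (rule dec_induct[of d d' "\<lambda>d. poly_below d g"]) (auto simp only: poly_below_Suc)

lemma poly_below_shift: "poly_below d g \<Longrightarrow> poly_below d (\<lambda>k. g (k + c))"
proof (induction d arbitrary: g)
  case (Suc d)
  have "poly_below d (\<lambda>k. g (k + c + h) - g (k + c))" for h
    using Suc.IH[of "\<lambda>k. g (k + h) - g k"] Suc.prems by simp
  then show ?case by (simp add: ac_simps)
qed auto

lemma poly_below_affine:
  "poly_below d g \<Longrightarrow> poly_below (Suc d) (\<lambda>k. (of_nat k + b) * g k)"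
proof (induction d arbitrary: g)
  case (Suc d)
  have "poly_below (Suc d) (\<lambda>k. (of_nat k + b) * (g (k + h) - g k) + of_nat h * g (k + h))" for h
    by (intro poly_below_add Suc.IH poly_below_cmult poly_below_shift Suc.prems)
      (use Suc.prems in auto)
  moreover have "(\<lambda>k. (of_nat (k + h) + b) * g (k + h) - (of_nat k + b) * g k) =
      (\<lambda>k. (of_nat k + b) * (g (k + h) - g k) + of_nat h * g (k + h))" for h
    by (simp add: algebra_simps)
  ultimately show ?case by (subst poly_below.simps) simp
qed auto

lemma poly_below_falling:
  assumes "poly_below d g"
  shows "poly_below (d + r) (\<lambda>k. falling r (of_nat k + b) * g k)"
proof (induction r)
  case (Suc r)
  have "poly_below (Suc (d + r)) (\<lambda>k. (of_nat k + (b - of_nat r)) * (falling r (of_nat k + b) * g k))"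
    by (rule poly_below_affine[OF Suc])
  then show ?case by (simp add: falling_def algebra_simps)
qed (use assms in \<open>simp add: falling_def\<close>)

lemma poly_below_antidifference:
  assumes P: "poly_below d P" and g: "\<And>k. g (Suc k) = g k + P k"
  shows "poly_below (Suc d) g"
proof -
  have "g (k + h) - g k = (\<Sum>s<h. P (k + s))" for h k
    by (induction h) (auto simp: g)
  moreover have "poly_below d (\<lambda>k. \<Sum>s<h. P (k + s))" for h
    by (intro poly_below_sum poly_below_shift P)
  ultimately show ?thesis by simp
qed

text \<open>
  The vanishing \<open>d\<close>-fold difference with step \<open>h\<close> expresses \<open>g k\<close> by \<open>d\<close> later samples.  Inductively,
  \<open>g k\<close> differs from \<open>g (k + h)\<close> by a sequence of lower degree; the constant satisfies
  \<open>1 + 2 \<cdot> 3\<^sup>d \<le> 3\<^sup>d\<^sup>+\<^sup>1\<close>.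
\<close>

lemma poly_below_le_samples:
  "poly_below d g \<Longrightarrow> cmod (g k) \<le> 3 ^ d * (\<Sum>s=1..d. cmod (g (k + s * h)))"
proof (induction d arbitrary: g)
  case (Suc d)
  let ?S = "\<Sum>s=1..Suc d. cmod (g (k + s * h))"
  have "cmod (g (k + h) - g k) \<le> 3 ^ d * (\<Sum>s=1..d. cmod (g (k + s * h + h) - g (k + s * h)))"
    by (rule Suc.IH) (use Suc.prems in simp)
  also have "\<dots> \<le> 3 ^ d * (\<Sum>s=1..d. cmod (g (k + Suc s * h)) + cmod (g (k + s * h)))"
    by (intro mult_left_mono sum_mono) (auto intro: order.trans[OF norm_triangle_ineq4] simp: algebra_simps)
  also have "\<dots> = 3 ^ d * ((\<Sum>s=1..d. cmod (g (k + Suc s * h))) + (\<Sum>s=1..d. cmod (g (k + s * h))))"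
    by (simp add: sum.distrib)
  also have "(\<Sum>s=1..d. cmod (g (k + Suc s * h))) = (\<Sum>s=2..Suc d. cmod (g (k + s * h)))"
    by (rule sum.reindex_bij_witness[of _ "\<lambda>s. s - 1" Suc]) auto
  also have "3 ^ d * (\<dots> + (\<Sum>s=1..d. cmod (g (k + s * h)))) \<le> 3 ^ d * (?S + ?S)"
    by (intro mult_left_mono add_mono sum_mono2) auto
  finally have 1: "cmod (g (k + h) - g k) \<le> 3 ^ d * (?S + ?S)" .
  have "cmod (g (k + 1 * h)) \<le> ?S"
    by (rule member_le_sum) auto
  also have "\<dots> \<le> 3 ^ d * ?S"
  proof -
    have "1 * ?S \<le> 3 ^ d * ?S" by (intro mult_right_mono sum_nonneg) auto
    then show ?thesis by simp
  qed
  finally have 2: "cmod (g (k + h)) \<le> 3 ^ d * ?S" by simp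
  have "cmod (g k) \<le> cmod (g (k + h)) + cmod (g (k + h) - g k)"
    by (metis norm_minus_commute norm_triangle_sub)
  then show ?case using 1 2 by (simp add: algebra_simps)
qed auto

text \<open>
  A polynomial sequence cannot be much larger at \<open>K\<close> than in the mean over a following block of
  length proportional to \<open>K + 1\<close>: average the preceding bound over the steps \<open>h = 1, \<dots>, K + 1\<close>.  For
  fixed \<open>s\<close> the samples \<open>K + s h\<close> are distinct and lie in the block.
\<close>

lemma poly_below_le_average:
  assumes "poly_below d g"
  shows "(real K + 1) * (cmod (g K))\<^sup>2 \<le> 9 ^ d * (real d)\<^sup>2 * (\<Sum>k=K+1..K+d*(K+1). (cmod (g k))\<^sup>2)"
proof -
  let ?A = "\<Sum>k=K+1..K+d*(K+1). (cmod (g k))\<^sup>2"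
  have 1: "(cmod (g K))\<^sup>2 \<le> 9 ^ d * real d * (\<Sum>s=1..d. (cmod (g (K + s * h)))\<^sup>2)" for h
  proof -
    have "(cmod (g K))\<^sup>2 \<le> (3 ^ d * (\<Sum>s=1..d. cmod (g (K + s * h))))\<^sup>2"
      by (intro power_mono poly_below_le_samples assms) auto
    also have "\<dots> = 9 ^ d * (\<Sum>s=1..d. 1 * cmod (g (K + s * h)))\<^sup>2"
    proof -
      have "((3 :: real) ^ d)\<^sup>2 = 9 ^ d" by (simp flip: power_mult) (simp add: power_mult mult.commute[of _ 2])
      then show ?thesis by (simp add: power_mult_distrib)
    qed
    also have "\<dots> \<le> 9 ^ d * ((\<Sum>s=1..d. 1\<^sup>2) * (\<Sum>s=1..d. (cmod (g (K + s * h)))\<^sup>2))"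
      by (intro mult_left_mono Cauchy_Schwarz_ineq_sum) auto
    finally show ?thesis by simp
  qed
  have 2: "(\<Sum>h=1..K+1. (cmod (g (K + s * h)))\<^sup>2) \<le> ?A" if s: "s \<in> {1..d}" for s
  proof -
    have "(\<Sum>h=1..K+1. (cmod (g (K + s * h)))\<^sup>2) = (\<Sum>k\<in>(\<lambda>h. K + s * h) ` {1..K+1}. (cmod (g k))\<^sup>2)"
      using s by (subst sum.reindex) (auto simp: inj_on_def)
    also have "\<dots> \<le> ?A"
    proof (rule sum_mono2)
      have "K + 1 \<le> K + s * h \<and> K + s * h \<le> K + d * (K + 1)" if "h \<in> {1..K+1}" for h
      proof -
        have "1 * 1 \<le> s * h" "s * h \<le> d * (K + 1)"
          using s that by (intro mult_le_mono; simp)+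
        then show ?thesis by simp
      qed
      then show "(\<lambda>h. K + s * h) ` {1..K+1} \<subseteq> {K+1..K+d*(K+1)}" by auto
    qed auto
    finally show ?thesis .
  qed
  have "(real K + 1) * (cmod (g K))\<^sup>2 = (\<Sum>h=1..K+1. (cmod (g K))\<^sup>2)"
    by simp
  also have "\<dots> \<le> (\<Sum>h=1..K+1. 9 ^ d * real d * (\<Sum>s=1..d. (cmod (g (K + s * h)))\<^sup>2))"
    by (intro sum_mono 1)
  also have "\<dots> = 9 ^ d * real d * (\<Sum>s=1..d. \<Sum>h=1..K+1. (cmod (g (K + s * h)))\<^sup>2)"
    unfolding sum_distrib_left[symmetric] by (subst sum.swap) simp
  also have "\<dots> \<le> 9 ^ d * real d * (\<Sum>s=1..d. ?A)"
    by (intro mult_left_mono sum_mono 2) auto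
  finally show ?thesis by (simp add: power2_eq_square mult_ac)
qed

section \<open>Taylor coefficients of disc automorphisms\<close>

text \<open>
  The Taylor coefficients at the origin of \<open>z \<mapsto> (z - a) / (1 - a z)\<close>.
\<close>

definition moebius_coeff :: "real \<Rightarrow> nat \<Rightarrow> real"
  where "moebius_coeff a k = (if k = 0 then - a else a ^ (k - 1) * (1 - a\<^sup>2))"

lemma Moebius_function_mem_moeb:
  assumes "cmod w < 1"
  shows "Moebius_function 0 w \<in> moeb"
proof -
  let ?f = "Moebius_function 0 w" and ?g = "Moebius_function 0 (- w)"
  have fg: "?f (?g z) = z" and gf: "?g (?f z) = z" if "z \<in> ball 0 1" for z
    using Moebius_function_compose[of w "-w" z] Moebius_function_compose[of "-w" w z] assms that by auto
  have maps: "?f ` ball 0 1 \<subseteq> ball 0 1" "?g ` ball 0 1 \<subseteq> ball 0 1"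
    using Moebius_function_norm_lt_1 assms by auto
  have bij: "bij_betw ?f (ball 0 1) (ball 0 1)"
    by (rule bij_betw_byWitness[where f' = ?g]) (use fg gf maps in auto)
  have "inv_into (ball 0 1) ?f z = ?g z" if "z \<in> ball 0 1" for z
    using that fg[OF that] maps bij
    by (intro inv_into_f_eq) (auto simp: bij_betw_def image_subset_iff)
  then have "inv_into (ball 0 1) ?f holomorphic_on ball 0 1"
    using Moebius_function_holomorphic[of "-w" 0] assms
    by (subst holomorphic_cong[where g = ?g]) auto
  then show ?thesis
    unfolding moeb_def using bij Moebius_function_holomorphic[OF assms] by simp
qed

lemma Moebius_function_power_series:
  assumes a: "0 \<le> a" "a < 1" and z: "cmod z < 1"
  shows "(\<lambda>k. of_real (moebius_coeff a k) * z ^ k) sums Moebius_function 0 (of_real a) z"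
proof -
  have "cmod (of_real a * z) < 1"
    using a z by (simp add: norm_mult) (metis abs_of_nonneg less_eq_real_def mult_strict_mono' mult.left_neutral norm_ge_zero mult_le_one not_le order.strict_trans1 mult_left_le_one_le)
  then have "(\<lambda>k. (of_real a * z) ^ k) sums (1 / (1 - of_real a * z))" and nz: "1 - of_real a * z \<noteq> 0"
    using geometric_sums by (blast, force)
  then have "(\<lambda>k. (1 - of_real (a\<^sup>2)) * z * (of_real a * z) ^ k) sums
      ((1 - of_real (a\<^sup>2)) * z * (1 / (1 - of_real a * z)))"
    by (intro sums_mult)
  moreover have "(1 - of_real (a\<^sup>2)) * z * (of_real a * z) ^ k
      = of_real (moebius_coeff a (Suc k)) * z ^ Suc k" for k
    by (simp add: moebius_coeff_def power_mult_distrib)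
  ultimately have "(\<lambda>k. of_real (moebius_coeff a (Suc k)) * z ^ Suc k) sums
      ((1 - of_real (a\<^sup>2)) * z * (1 / (1 - of_real a * z)))" by (simp only:)
  from sums_Suc[where f = "\<lambda>k. of_real (moebius_coeff a k) * z ^ k", OF this]
  have "(\<lambda>k. of_real (moebius_coeff a k) * z ^ k) sums
      ((1 - of_real (a\<^sup>2)) * z * (1 / (1 - of_real a * z)) - of_real a)"
    by (simp add: moebius_coeff_def[of a 0])
  moreover have "(1 - of_real (a\<^sup>2)) * z * (1 / (1 - of_real a * z)) - of_real a
      = Moebius_function 0 (of_real a) z"
    using nz by (simp add: Moebius_function_simple field_simps power2_eq_square)
  ultimately show ?thesis by simp
qed

text \<open>
  Choosing \<open>1 - a\<close> of order \<open>1 / L\<close> keeps the coefficients with index \<open>1, \<dots>, L\<close> at least of order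
  \<open>1 / L\<close>: the powers of \<open>a\<close> stay above \<open>1/2\<close> by Bernoulli's inequality, and
  \<open>1 - a\<^sup>2 \<ge> 1 - a\<close>.
\<close>

lemma moebius_coeff_lower:
  assumes k: "1 \<le> k" "k \<le> L"
  shows "1 / (4 * (real L + 1)) \<le> moebius_coeff (1 - 1 / (2 * (real L + 1))) k"
proof -
  define t where "t = 1 / (2 * (real L + 1))"
  have t: "0 < t" "t \<le> 1 / 2" by (auto simp: t_def field_simps)
  have "1 / 2 \<le> 1 + real L * (- t)" by (simp add: t_def field_simps)
  also have "\<dots> \<le> (1 + (- t)) ^ L" by (rule Bernoulli_inequality) (use t in auto)
  also have "\<dots> \<le> (1 - t) ^ (k - 1)"
    using power_decreasing[of "k - 1" L "1 - t"] k t by simp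
  finally have 1: "1 / 2 \<le> (1 - t) ^ (k - 1)" .
  have 2: "t \<le> 1 - (1 - t)\<^sup>2"
  proof -
    have "t\<^sup>2 \<le> t" using t by (simp add: power2_eq_square mult_left_le_one_le)
    then show ?thesis by (simp add: power2_diff)
  qed
  have "1 / 2 * t \<le> (1 - t) ^ (k - 1) * (1 - (1 - t)\<^sup>2)"
    by (intro mult_mono 1 2) (use t in auto)
  moreover have "1 / (4 * (real L + 1)) = 1 / 2 * t" by (simp add: t_def)
  ultimately show ?thesis unfolding t_def[symmetric] using k by (simp add: moebius_coeff_def)
qed

section \<open>The functional calculus on nilpotent vectors\<close>

context complex_hilbert_space
begin

lemma hnorm_le_op_norm:
  assumes B: "bounded_operator H H B" and x: "x \<in> carrier H"
  shows "hnorm H (B x) \<le> op_norm H B * hnorm H x"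
proof -
  obtain C where C: "\<And>x. x \<in> carrier H \<Longrightarrow> hnorm H (B x) \<le> C * hnorm H x"
    and Bm: "\<And>x. x \<in> carrier H \<Longrightarrow> B x \<in> carrier H"
    and Bs: "\<And>a x. x \<in> carrier H \<Longrightarrow> B (a *\<^sub>C x) = a *\<^sub>C B x"
    using B unfolding bounded_operator_def by blast
  have bdd: "bdd_above ((\<lambda>x. hnorm H (B x)) ` {x \<in> carrier H. hnorm H x \<le> 1})"
  proof (rule bdd_aboveI2)
    fix y assume "y \<in> {x \<in> carrier H. hnorm H x \<le> 1}"
    then have y: "y \<in> carrier H" "hnorm H y \<le> 1" by auto
    have "hnorm H (B y) \<le> C * hnorm H y" using C y by simp
    also have "\<dots> \<le> \<bar>C\<bar> * 1" using y by (intro mult_mono) auto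
    finally show "hnorm H (B y) \<le> \<bar>C\<bar>" by simp
  qed
  show ?thesis
  proof (cases "hnorm H x = 0")
    case True
    then show ?thesis using C[OF x] by simp
  next
    case False
    then have p: "hnorm H x > 0" using hnorm_ge_0[OF x] by linarith
    define y where "y = of_real (1 / hnorm H x) *\<^sub>C x"
    have y: "y \<in> carrier H" "hnorm H y = 1" unfolding y_def using x p
      by (auto simp: scaleC_mem hnorm_scaleC simp del: of_real_divide)
    have "hnorm H (B y) \<le> op_norm H B"
      unfolding op_norm_def by (rule cSUP_upper[OF _ bdd]) (use y in auto)
    moreover have "hnorm H (B y) = hnorm H (B x) / hnorm H x"
      unfolding y_def using p by (simp add: Bs x Bm hnorm_scaleC norm_divide)
    ultimately show ?thesis using p by (simp add: field_simps)
  qed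
qed

lemma op_norm_le:
  assumes "\<And>x. x \<in> carrier H \<Longrightarrow> hnorm H (A x) \<le> C * hnorm H x" "0 \<le> C"
  shows "op_norm H A \<le> C"
  unfolding op_norm_def
proof (rule cSUP_least)
  show "{x \<in> carrier H. hnorm H x \<le> 1} \<noteq> {}" using zero_mem by (auto intro!: exI[of _ 0])
  fix x assume x: "x \<in> {x \<in> carrier H. hnorm H x \<le> 1}"
  have "hnorm H (A x) \<le> C * hnorm H x" using assms(1) x by simp
  also have "\<dots> \<le> C * 1" using assms(2) x by (intro mult_left_mono) auto
  finally show "hnorm H (A x) \<le> C" by simp
qed

lemma funpow_mem:
  "bounded_operator H H T \<Longrightarrow> y \<in> carrier H \<Longrightarrow> (T ^^ k) y \<in> carrier H"
  by (induction k) (auto simp: bounded_operator_def)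

lemma bounded_operator_sum:
  assumes "bounded_operator H H2 A" "\<And>i. i \<in> I \<Longrightarrow> f i \<in> carrier H"
  shows "A (sum f I) = (\<Sum>i\<in>I. A (f i))"
proof -
  have "A (0 *\<^sub>C 0) = 0 *\<^sub>C A 0"
    using assms(1) zero_mem unfolding bounded_operator_def by blast
  then have "A 0 = 0" by simp
  then show ?thesis using assms(2)
    by (induction I rule: infinite_finite_induct)
      (use assms(1) in \<open>auto simp: bounded_operator_def sum_mem\<close>)
qed

text \<open>
  On a vector annihilated by a power of \<open>T\<close> the Neumann series of the resolvent terminates, so it
  represents the resolvent at every nonzero point off the spectrum.
\<close>

lemma resolvent_nilpotent:
  assumes T: "bounded_operator H H T" and z: "z \<notin> spectrum H T" "z \<noteq> 0"
    and y: "y \<in> carrier H" and nil: "(T ^^ Q) y = 0"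
  shows "resolvent H T z y = (\<Sum>k<Q. (1 / z ^ Suc k) *\<^sub>C (T ^^ k) y)"
proof -
  obtain B where B: "\<And>x. x \<in> carrier H \<Longrightarrow> B (z *\<^sub>C x - T x) = x"
    using z unfolding spectrum_def by blast
  have inj: "inj_on (\<lambda>x. z *\<^sub>C x - T x) (carrier H)"
    using B by (rule inj_on_inverseI)
  define s where "s = (\<Sum>k<Q. (1 / z ^ Suc k) *\<^sub>C (T ^^ k) y)"
  have m: "(1 / z ^ Suc k) *\<^sub>C (T ^^ k) y \<in> carrier H" for k
    by (intro scaleC_mem funpow_mem T y)
  have s: "s \<in> carrier H" unfolding s_def by (intro sum_mem m)
  have scaleC_sum: "z *\<^sub>C sum f I = (\<Sum>i\<in>I. z *\<^sub>C f i)" for f :: "nat \<Rightarrow> 'v" and I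
    by (induction I rule: infinite_finite_induct) (auto simp: scaleC_add_right)
  have "z *\<^sub>C s - T s = (\<Sum>k<Q. z *\<^sub>C (1 / z ^ Suc k) *\<^sub>C (T ^^ k) y - T ((1 / z ^ Suc k) *\<^sub>C (T ^^ k) y))"
    unfolding s_def by (simp only: scaleC_sum bounded_operator_sum[OF T m] sum_subtractf)
  also have "\<dots> = (\<Sum>k<Q. (1 / z ^ k) *\<^sub>C (T ^^ k) y - (1 / z ^ Suc k) *\<^sub>C (T ^^ Suc k) y)"
  proof (intro sum.cong refl)
    fix k
    have "T ((1 / z ^ Suc k) *\<^sub>C (T ^^ k) y) = (1 / z ^ Suc k) *\<^sub>C T ((T ^^ k) y)"
      using T funpow_mem[OF T y] unfolding bounded_operator_def by blast
    then show "z *\<^sub>C (1 / z ^ Suc k) *\<^sub>C (T ^^ k) y - T ((1 / z ^ Suc k) *\<^sub>C (T ^^ k) y) =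
        (1 / z ^ k) *\<^sub>C (T ^^ k) y - (1 / z ^ Suc k) *\<^sub>C (T ^^ Suc k) y"
      using z by (simp add: scaleC_scaleC)
  qed
  also have "\<dots> = y"
    by (subst sum_lessThan_telescope') (simp add: nil scaleC_one)
  finally have "z *\<^sub>C s - T s = y" .
  then show ?thesis
    unfolding resolvent_def s_def[symmetric] using inv_into_f_f[OF inj s] by simp
qed

text \<open>
  By the preceding formula the contour integral is a finite sum of Cauchy integrals for the Taylor
  coefficients of \<open>\<phi>\<close>: on such vectors \<open>\<phi>(T)\<close> is the power series evaluated at \<open>T\<close>.
\<close>

lemma functional_calculus_nilpotent:
  assumes B: "is_functional_calculus H T \<phi> B" and T: "bounded_operator H H T"
    and spec: "spectrum H T \<subseteq> cball 0 1"
    and \<phi>: "\<And>z. cmod z < 1 \<Longrightarrow> (\<lambda>k. c k * z ^ k) sums \<phi> z"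
    and y: "y \<in> carrier H" and nil: "(T ^^ Q) y = 0" and x: "x \<in> carrier H"
  shows "ip H (B y) x = (\<Sum>k<Q. c k * ip H ((T ^^ k) y) x)"
proof -
  obtain f r R where r: "1 < r" "r < R" and f: "f holomorphic_on ball 0 R"
    and f\<phi>: "\<And>z. z \<in> ball 0 1 \<Longrightarrow> f z = \<phi> z"
    and int: "((\<lambda>z. f z * ip H (resolvent H T z y) x) has_contour_integral
          2 * of_real pi * \<i> * ip H (B y) x) (circlepath 0 r)"
    using B x y unfolding is_functional_calculus_def by blast
  have fc: "(deriv ^^ k) f 0 / fact k = c k" for k
  proof (rule powser_unique[where r = 1 and a = "\<lambda>k. (deriv ^^ k) f 0 / fact k" and b = c])
    fix w :: complex assume w: "cmod w < 1"
    have "f holomorphic_on ball 0 1"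
      by (rule holomorphic_on_subset[OF f]) (use r in auto)
    from holomorphic_power_series[OF this, of w] w
    show "(\<lambda>n. (deriv ^^ n) f 0 / fact n * w ^ n) sums \<phi> w" by (simp add: f\<phi>)
  qed (use \<phi> in auto)
  have cont: "continuous_on (cball 0 r) f"
    by (rule holomorphic_on_imp_continuous_on, rule holomorphic_on_subset[OF f]) (use r in auto)
  have hol: "f holomorphic_on ball 0 r"
    by (rule holomorphic_on_subset[OF f]) (use r in auto)
  have one: "((\<lambda>z. f z / z ^ Suc k) has_contour_integral 2 * of_real pi * \<i> * c k) (circlepath 0 r)" for k
    using Cauchy_has_contour_integral_higher_derivative_circlepath[OF cont hol, of 0 k] r fc[of k]
    by (simp add: field_simps)
  have "((\<lambda>z. \<Sum>k<Q. f z / z ^ Suc k * ip H ((T ^^ k) y) x) has_contour_integral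
      (\<Sum>k<Q. 2 * of_real pi * \<i> * c k * ip H ((T ^^ k) y) x)) (circlepath 0 r)"
    by (intro has_contour_integral_sum has_contour_integral_rmul one) auto
  moreover have "(\<Sum>k<Q. f z / z ^ Suc k * ip H ((T ^^ k) y) x) = f z * ip H (resolvent H T z y) x"
    if z: "z \<in> path_image (circlepath 0 r)" for z
  proof -
    have "cmod z = r" using z r by simp
    then have "z \<notin> spectrum H T" "z \<noteq> 0" using spec r by auto
    then have "ip H (resolvent H T z y) x = (\<Sum>k<Q. ip H ((1 / z ^ Suc k) *\<^sub>C (T ^^ k) y) x)"
      by (subst resolvent_nilpotent[OF T _ _ y nil]) (auto intro!: inner_sum_left scaleC_mem funpow_mem T x y)
    then show ?thesis
      by (simp add: inner_scaleC_left funpow_mem[OF T y] x sum_distrib_left)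
  qed
  ultimately have "((\<lambda>z. f z * ip H (resolvent H T z y) x) has_contour_integral
      (\<Sum>k<Q. 2 * of_real pi * \<i> * c k * ip H ((T ^^ k) y) x)) (circlepath 0 r)"
    by (rule has_contour_integral_eq)
  from has_contour_integral_unique[OF int this]
  have "2 * of_real pi * \<i> * ip H (B y) x = 2 * of_real pi * \<i> * (\<Sum>k<Q. c k * ip H ((T ^^ k) y) x)"
    by (simp add: sum_distrib_left mult_ac)
  then show ?thesis by simp
qed

end

section \<open>Direct sums\<close>

lemma direct_sum_simps:
  "F \<in> carrier (direct_sum n H) \<longleftrightarrow> (\<forall>i<n. F i \<in> carrier (H i)) \<and> (\<forall>i\<ge>n. F i = 0)"
  "ip (direct_sum n H) F G = (\<Sum>i<n. ip (H i) (F i) (G i))"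
  by (auto simp: direct_sum_def)

lemma direct_sum_hnorm:
  assumes "\<And>i. i < n \<Longrightarrow> complex_hilbert_space (H i)" and F: "F \<in> carrier (direct_sum n H)"
  shows "(hnorm (direct_sum n H) F)\<^sup>2 = (\<Sum>i<n. (hnorm (H i) (F i))\<^sup>2)"
proof -
  have "Re (ip (H i) (F i) (F i)) = (hnorm (H i) (F i))\<^sup>2" if "i < n" for i
    using complex_hilbert_space.hnorm_sq[OF assms(1)[OF that]] F that by (simp add: direct_sum_simps)
  then have "Re (ip (direct_sum n H) F F) = (\<Sum>i<n. (hnorm (H i) (F i))\<^sup>2)"
    by (simp add: direct_sum_simps)
  then show ?thesis unfolding hnorm_def[of "direct_sum n H"] by (simp add: sum_nonneg)
qed

lemma direct_sum_hilbert_space: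
  assumes H: "\<And>i. i < n \<Longrightarrow> complex_hilbert_space (H i)"
  shows "complex_hilbert_space (direct_sum n H)"
proof -
  let ?D = "direct_sum n H"
  have norm_D: "(hnorm ?D F)\<^sup>2 = (\<Sum>i<n. (hnorm (H i) (F i))\<^sup>2)" if "F \<in> carrier ?D" for F
    by (rule direct_sum_hnorm[OF _ that]) (rule H)
  have comp: "hnorm (H i) (F i) \<le> hnorm ?D F" if "F \<in> carrier ?D" "i < n" for F i
  proof (rule power2_le_imp_le)
    show "(hnorm (H i) (F i))\<^sup>2 \<le> (hnorm ?D F)\<^sup>2"
      unfolding norm_D[OF that(1)] by (rule member_le_sum) (use that in auto)
    show "0 \<le> hnorm ?D F"
      unfolding hnorm_def using that complex_hilbert_space.inner_nonneg[OF H]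
      by (auto simp: direct_sum_simps intro!: sum_nonneg)
  qed
  have diff: "F - G \<in> carrier ?D" if "F \<in> carrier ?D" "G \<in> carrier ?D" for F G
    using that complex_hilbert_space.diff_mem[OF H] by (simp add: direct_sum_simps)
  show ?thesis
  proof
    show "0 \<in> carrier ?D"
      using complex_hilbert_space.zero_mem[OF H] by (simp add: direct_sum_simps)
    fix x y z :: "nat \<Rightarrow> 'a" and a
    assume x: "x \<in> carrier ?D"
    show "a *\<^sub>C x \<in> carrier ?D"
      using x complex_hilbert_space.scaleC_mem[OF H] by (simp add: direct_sum_simps scaleC_apply)
    show "0 \<le> Re (ip ?D x x)"
      using x complex_hilbert_space.inner_nonneg[OF H]
      by (auto simp: direct_sum_simps intro!: sum_nonneg)
    show "x = 0" if "ip ?D x x = 0"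
    proof
      fix i
      show "x i = 0 i"
      proof (cases "i < n")
        case True
        have "(hnorm ?D x)\<^sup>2 = 0" using that unfolding hnorm_def by simp
        then have "hnorm (H i) (x i) = 0"
          using comp[OF x True] x True complex_hilbert_space.hnorm_ge_0[OF H[OF True], of "x i"]
          by (simp add: direct_sum_simps)
        then show ?thesis using x True complex_hilbert_space.hnorm_eq_0D[OF H[OF True]]
          by (simp add: direct_sum_simps)
      qed (use x in \<open>simp add: direct_sum_simps\<close>)
    qed
    assume y: "y \<in> carrier ?D"
    show "x + y \<in> carrier ?D"
      using x y complex_hilbert_space.add_mem[OF H] by (simp add: direct_sum_simps)
    show "ip ?D (a *\<^sub>C x) y = a * ip ?D x y"
      using x y by (simp add: direct_sum_simps scaleC_apply sum_distrib_left
          complex_hilbert_space.inner_scaleC_left[OF H])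
    show "ip ?D y x = cnj (ip ?D x y)"
      unfolding direct_sum_simps cnj_sum
      by (intro sum.cong refl complex_hilbert_space.inner_commute[OF H])
        (use x y in \<open>auto simp: direct_sum_simps\<close>)
    assume z: "z \<in> carrier ?D"
    show "ip ?D (x + y) z = ip ?D x z + ip ?D y z"
      using x y z by (simp add: direct_sum_simps complex_hilbert_space.inner_add_left[OF H] sum.distrib)
  next
    fix X :: "nat \<Rightarrow> nat \<Rightarrow> 'a"
    assume X: "\<And>k. X k \<in> carrier ?D"
      and C: "\<And>e. e > 0 \<Longrightarrow> \<exists>N. \<forall>j\<ge>N. \<forall>k\<ge>N. hnorm ?D (X j - X k) < e"
    have "\<exists>g\<in>carrier (H i). (\<lambda>k. hnorm (H i) (X k i - g)) \<longlonglongrightarrow> 0" if i: "i < n" for i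
    proof (rule complex_hilbert_space.complete[OF H[OF i]])
      show "X k i \<in> carrier (H i)" for k using X i by (simp add: direct_sum_simps)
      fix e :: real assume "e > 0"
      then obtain N where N: "\<And>j k. j \<ge> N \<Longrightarrow> k \<ge> N \<Longrightarrow> hnorm ?D (X j - X k) < e" using C by blast
      have "hnorm (H i) (X j i - X k i) < e" if "j \<ge> N" "k \<ge> N" for j k
        using comp[OF diff[OF X X] i, of j k] N[OF that] by simp
      then show "\<exists>N. \<forall>j\<ge>N. \<forall>k\<ge>N. hnorm (H i) (X j i - X k i) < e" by blast
    qed
    then obtain g where g: "\<And>i. i < n \<Longrightarrow> g i \<in> carrier (H i)"
      and lim: "\<And>i. i < n \<Longrightarrow> (\<lambda>k. hnorm (H i) (X k i - g i)) \<longlonglongrightarrow> 0"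
      by metis
    define G where "G i = (if i < n then g i else 0)" for i
    have G: "G \<in> carrier ?D" using g by (auto simp: direct_sum_simps G_def)
    have "(\<lambda>k. \<Sum>i<n. (hnorm (H i) (X k i - G i))\<^sup>2) \<longlonglongrightarrow> (\<Sum>i<n. 0\<^sup>2)"
      by (intro tendsto_sum tendsto_power) (use lim in \<open>simp add: G_def\<close>)
    then have "(\<lambda>k. sqrt ((hnorm ?D (X k - G))\<^sup>2)) \<longlonglongrightarrow> sqrt 0"
      by (intro tendsto_real_sqrt) (simp add: norm_D[OF diff[OF X G]])
    moreover have "0 \<le> hnorm ?D (X k - G)" for k
      unfolding hnorm_def using diff[OF X G, of k] complex_hilbert_space.inner_nonneg[OF H]
      by (auto simp: direct_sum_simps intro!: sum_nonneg)
    ultimately have "(\<lambda>k. hnorm ?D (X k - G)) \<longlonglongrightarrow> 0" by simp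
    then show "\<exists>x\<in>carrier ?D. (\<lambda>k. hnorm ?D (X k - x)) \<longlonglongrightarrow> 0" using G by blast
  qed
qed

section \<open>Powers of a quasi-homogeneous operator\<close>

locale quasi_homogeneous_operator =
  fixes n :: nat and l :: "nat \<Rightarrow> real"
    and H :: "nat \<Rightarrow> (complex \<Rightarrow> complex) inner_space"
    and T :: "(nat \<Rightarrow> complex \<Rightarrow> complex) \<Rightarrow> nat \<Rightarrow> complex \<Rightarrow> complex"
    and A :: "nat \<Rightarrow> nat \<Rightarrow> (complex \<Rightarrow> complex) \<Rightarrow> complex \<Rightarrow> complex"
    and m :: "nat \<Rightarrow> nat \<Rightarrow> complex"
  assumes weighted_space: "i < n \<Longrightarrow> weighted_space (H i) (l i)"
    and bounded: "bounded_operator (direct_sum n H) (direct_sum n H) T"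
    and entry_bounded: "\<lbrakk>i < n; j < n\<rbrakk> \<Longrightarrow> bounded_operator (H j) (H i) (A i j)"
    and diagonal: "i < n \<Longrightarrow> is_adjoint (H i) mult_z (A i i)"
    and above: "\<lbrakk>i < j; j < n; cmod w < 1\<rbrakk> \<Longrightarrow>
      A i j (disc_kernel (l j) w) = m i j *\<^sub>C dbar_kernel (j - i - 1) (l i) w"
    and below: "\<lbrakk>j < i; i < n; f \<in> carrier (H j)\<rbrakk> \<Longrightarrow> A i j f = 0"
    and entries: "\<lbrakk>F \<in> carrier (direct_sum n H); i < n\<rbrakk> \<Longrightarrow> T F i = (\<Sum>j<n. A i j (F j))"
begin

abbreviation D :: "(nat \<Rightarrow> complex \<Rightarrow> complex) inner_space"
  where "D \<equiv> direct_sum n H"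

lemma hilbert: "i < n \<Longrightarrow> complex_hilbert_space (H i)"
  using weighted_space by (simp add: weighted_space_def)

sublocale D: complex_hilbert_space D
  by (rule direct_sum_hilbert_space) (rule hilbert)

lemma norm_D: "F \<in> carrier D \<Longrightarrow> (hnorm D F)\<^sup>2 = (\<Sum>i<n. (hnorm (H i) (F i))\<^sup>2)"
  by (rule direct_sum_hnorm) (rule hilbert)

lemma component_mem: "F \<in> carrier D \<Longrightarrow> i < n \<Longrightarrow> F i \<in> carrier (H i)"
  by (simp add: direct_sum_simps)

lemma T_mem: "F \<in> carrier D \<Longrightarrow> T F \<in> carrier D"
  using bounded by (simp add: bounded_operator_def)

text \<open>
  Integer indices allow shifts below zero, where the value is \<open>0\<close>.
\<close>

definition coefficient :: "(nat \<Rightarrow> complex \<Rightarrow> complex) \<Rightarrow> nat \<Rightarrow> int \<Rightarrow> complex"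
  where "coefficient F i x = (if x < 0 then 0 else ip (H i) (F i) (disc_monom (nat x)))"

text \<open>
  With \<open>z\<^sup>x\<close> in the \<open>i\<close>-th summand given degree \<open>x + i\<close>, every inner product on the right belongs to a
  monomial of degree one more than on the left.  So \<open>T\<close> lowers degrees by exactly one.
\<close>

lemma coefficient_step:
  assumes F: "F \<in> carrier D" and i: "i < n" and x: "x \<ge> 0"
  shows "coefficient (T F) i x = coefficient F i (x + 1) +
    (\<Sum>j\<in>{i<..<n}. m i j * falling (j - i - 1) (of_int x) * coefficient F j (x - int (j - i - 1)))"
proof -
  interpret Hi: weighted_space "H i" "l i" by (rule weighted_space[OF i])
  define N where "N = nat x"
  have xN: "x = int N" using x by (simp add: N_def)
  have Am: "A i j (F j) \<in> carrier (H i)" if "j < n" for j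
    using entry_bounded[OF i that] component_mem[OF F that] unfolding bounded_operator_def by blast
  have "ip (H i) (T F i) (disc_monom N) = (\<Sum>j<n. ip (H i) (A i j (F j)) (disc_monom N))"
    unfolding entries[OF F i] by (rule Hi.inner_sum_left) (use Am Hi.monom_mem in auto)
  also have "\<dots> = (\<Sum>j\<in>insert i {i<..<n}. ip (H i) (A i j (F j)) (disc_monom N))"
  proof (rule sum.mono_neutral_right)
    show "\<forall>j\<in>{..<n} - insert i {i<..<n}. ip (H i) (A i j (F j)) (disc_monom N) = 0"
    proof
      fix j assume "j \<in> {..<n} - insert i {i<..<n}"
      then have "j < i" "j < n" by auto
      then have "A i j (F j) = 0" by (intro below i component_mem F)
      then show "ip (H i) (A i j (F j)) (disc_monom N) = 0"
        by (simp add: Hi.inner_zero_left Hi.monom_mem)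
    qed
  qed (use i in auto)
  also have "\<dots> = ip (H i) (A i i (F i)) (disc_monom N) +
      (\<Sum>j\<in>{i<..<n}. ip (H i) (A i j (F j)) (disc_monom N))"
    by simp
  also have "ip (H i) (A i i (F i)) (disc_monom N) = coefficient F i (x + 1)"
    using Hi.adjoint_shift_coefficient[OF diagonal[OF i] component_mem[OF F i], of N]
    by (simp add: coefficient_def xN nat_add_distrib)
  also have "(\<Sum>j\<in>{i<..<n}. ip (H i) (A i j (F j)) (disc_monom N)) =
    (\<Sum>j\<in>{i<..<n}. m i j * falling (j - i - 1) (of_int x) * coefficient F j (x - int (j - i - 1)))"
  proof (rule sum.cong[OF refl])
    fix j assume "j \<in> {i<..<n}"
    then have j: "i < j" "j < n" by auto
    have "ip (H i) (A i j (F j)) (disc_monom N) = m i j * falling (j - i - 1) (of_nat N) *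
        (if j - i - 1 \<le> N then ip (H j) (F j) (disc_monom (N - (j - i - 1))) else 0)"
      by (rule kernel_intertwiner_coefficient[OF weighted_space[OF j(2)] weighted_space[OF i]
            entry_bounded[OF i j(2)] above[OF j] component_mem[OF F j(2)]])
    moreover have "(if j - i - 1 \<le> N then ip (H j) (F j) (disc_monom (N - (j - i - 1))) else 0)
        = coefficient F j (x - int (j - i - 1))"
      by (auto simp: coefficient_def xN nat_diff_distrib simp flip: of_nat_diff)
    ultimately show "ip (H i) (A i j (F j)) (disc_monom N) =
        m i j * falling (j - i - 1) (of_int x) * coefficient F j (x - int (j - i - 1))"
      by (simp add: xN)
  qed
  finally show ?thesis using x by (simp add: coefficient_def[of "T F"] N_def)
qed

text \<open>
  The scalar with which \<open>\<langle>F\<^sub>j, z\<^sup>N\<^sup>+\<^sup>k\<^sup>+\<^sup>i\<^sup>-\<^sup>j\<rangle>\<close> enters \<open>\<langle>(T\<^sup>k F)\<^sub>i, z\<^sup>N\<rangle>\<close>, that is, the sum over all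
  ways to pass from the \<open>i\<close>-th to the \<open>j\<close>-th summand in \<open>k\<close> steps of the products of the factors
  met on the way.
\<close>

primrec path_coeff :: "nat \<Rightarrow> nat \<Rightarrow> nat \<Rightarrow> nat \<Rightarrow> complex" where
  "path_coeff i N 0 = (\<lambda>j. if j = i then 1 else 0)"
| "path_coeff i N (Suc k) = (\<lambda>j. path_coeff i N k j +
    (\<Sum>p\<in>{i..<j}. path_coeff i N k p * m p j * falling (j - p - 1) (of_nat (N + k + i) - of_nat p)))"

text \<open>
  The recursion for inner products holds at nonnegative indices only.  Negative ones carry no weight:
  a step that would lead to one contains a vanishing falling factorial.
\<close>

lemma path_coeff_negative: "N + k + i < j \<Longrightarrow> path_coeff i N k j = 0"
proof (induction k arbitrary: j)
  case (Suc k)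
  have "path_coeff i N k p * m p j * falling (j - p - 1) (of_nat (N + k + i) - of_nat p) = 0"
    if p: "p \<in> {i..<j}" for p
  proof (cases "N + k + i < p")
    case True
    then show ?thesis by (simp add: Suc.IH)
  next
    case False
    then have "falling (j - p - 1) (of_nat (N + k + i - p)) = 0"
      using Suc.prems p by (intro falling_eq_0) auto
    then show ?thesis using False by (simp add: of_nat_diff)
  qed
  then have "(\<Sum>p\<in>{i..<j}. path_coeff i N k p * m p j *
      falling (j - p - 1) (of_nat (N + k + i) - of_nat p)) = 0"
    by (intro sum.neutral) blast
  moreover have "path_coeff i N k j = 0" using Suc by simp
  ultimately show ?case by (simp only: path_coeff.simps add_0_right)
qed auto

lemma coefficient_power:
  assumes "F \<in> carrier D" and i: "i < n"
  shows "coefficient ((T ^^ k) F) i (int N) =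
    (\<Sum>j\<in>{i..<n}. path_coeff i N k j * coefficient F j (int (N + k + i) - int j))"
  using assms(1)
proof (induction k arbitrary: F)
  case 0
  have "(\<Sum>j\<in>{i..<n}. path_coeff i N 0 j * coefficient F j (int (N + 0 + i) - int j)) =
      (\<Sum>j\<in>{i..<n}. if j = i then coefficient F j (int (N + 0 + i) - int j) else 0)"
    by (intro sum.cong) auto
  then show ?case using i by simp
next
  case (Suc k)
  let ?R = "path_coeff i N k" and ?x = "\<lambda>k j. int (N + k + i) - int j"
  let ?g = "\<lambda>p j. m p j * falling (j - p - 1) (of_nat (N + k + i) - of_nat p)"
  have "coefficient ((T ^^ Suc k) F) i (int N) = coefficient ((T ^^ k) (T F)) i (int N)"
    by (simp add: funpow_swap1)
  also have "\<dots> = (\<Sum>p\<in>{i..<n}. ?R p * coefficient (T F) p (?x k p))"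
    by (rule Suc.IH[OF T_mem[OF Suc.prems]])
  also have "\<dots> = (\<Sum>p\<in>{i..<n}. ?R p * coefficient F p (?x (Suc k) p) +
      (\<Sum>j\<in>{j\<in>{i..<n}. p < j}. ?R p * ?g p j * coefficient F j (?x (Suc k) j)))"
  proof (rule sum.cong[OF refl])
    fix p assume p: "p \<in> {i..<n}"
    show "?R p * coefficient (T F) p (?x k p) = ?R p * coefficient F p (?x (Suc k) p) +
      (\<Sum>j\<in>{j\<in>{i..<n}. p < j}. ?R p * ?g p j * coefficient F j (?x (Suc k) j))"
    proof (cases "N + k + i < p")
      case True
      then show ?thesis by (simp add: path_coeff_negative)
    next
      case False
      then have "coefficient (T F) p (?x k p) = coefficient F p (?x k p + 1) + (\<Sum>j\<in>{p<..<n}.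
          m p j * falling (j - p - 1) (of_int (?x k p)) * coefficient F j (?x k p - int (j - p - 1)))"
        using p by (intro coefficient_step Suc.prems) auto
      also have "?x k p + 1 = ?x (Suc k) p" by simp
      also have "(\<Sum>j\<in>{p<..<n}.
          m p j * falling (j - p - 1) (of_int (?x k p)) * coefficient F j (?x k p - int (j - p - 1))) =
          (\<Sum>j\<in>{j\<in>{i..<n}. p < j}. ?g p j * coefficient F j (?x (Suc k) j))"
      proof (rule sum.cong)
        fix j assume j: "j \<in> {j\<in>{i..<n}. p < j}"
        then have "?x k p - int (j - p - 1) = ?x (Suc k) j" by (auto simp: of_nat_diff)
        moreover have "of_int (?x k p) = (of_nat (N + k + i) - of_nat p :: complex)" by simp
        ultimately show "m p j * falling (j - p - 1) (of_int (?x k p)) * coefficient F j (?x k p - int (j - p - 1)) =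
            ?g p j * coefficient F j (?x (Suc k) j)" by (simp only:)
      qed (use p in auto)
      finally show ?thesis by (simp add: distrib_left sum_distrib_left mult.assoc)
    qed
  qed
  also have "\<dots> = (\<Sum>j\<in>{i..<n}. ?R j * coefficient F j (?x (Suc k) j)) +
      (\<Sum>p\<in>{i..<n}. \<Sum>j\<in>{j\<in>{i..<n}. p < j}. ?R p * ?g p j * coefficient F j (?x (Suc k) j))"
    by (rule sum.distrib)
  also have "(\<Sum>p\<in>{i..<n}. \<Sum>j\<in>{j\<in>{i..<n}. p < j}. ?R p * ?g p j * coefficient F j (?x (Suc k) j)) =
      (\<Sum>j\<in>{i..<n}. \<Sum>p\<in>{p\<in>{i..<n}. p < j}. ?R p * ?g p j * coefficient F j (?x (Suc k) j))"
    by (rule sum.swap_restrict) auto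
  also have "\<dots> = (\<Sum>j\<in>{i..<n}. (\<Sum>p\<in>{i..<j}. ?R p * ?g p j) * coefficient F j (?x (Suc k) j))"
    unfolding sum_distrib_right by (intro sum.cong refl) auto
  also have "(\<Sum>j\<in>{i..<n}. ?R j * coefficient F j (?x (Suc k) j)) + \<dots> =
      (\<Sum>j\<in>{i..<n}. path_coeff i N (Suc k) j * coefficient F j (?x (Suc k) j))"
    unfolding sum.distrib[symmetric] by (simp add: distrib_right mult.assoc)
  finally show ?case .
qed

text \<open>
  The increments in \<open>k\<close> are combinations of path coefficients with smaller \<open>j\<close>, multiplied by falling
  factorials that are polynomials in \<open>k\<close>; summation raises the degree by one.  The degree bound is
  independent of \<open>N\<close>, which makes all later constants uniform.
\<close>

lemma path_coeff_poly: "poly_below (Suc (j - i)) (\<lambda>k. path_coeff i N k j)"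
proof (induction j rule: less_induct)
  case (less j)
  have "poly_below (j - i) (\<lambda>k. \<Sum>p\<in>{i..<j}.
      m p j * (falling (j - p - 1) (of_nat k + (of_nat N + of_nat i - of_nat p)) * path_coeff i N k p))"
  proof (intro poly_below_sum poly_below_cmult)
    fix p assume p: "p \<in> {i..<j}"
    then have "poly_below (Suc (p - i) + (j - p - 1))
        (\<lambda>k. falling (j - p - 1) (of_nat k + (of_nat N + of_nat i - of_nat p)) * path_coeff i N k p)"
      by (intro poly_below_falling less) auto
    moreover have "Suc (p - i) + (j - p - 1) = j - i" using p by auto
    ultimately show "poly_below (j - i)
        (\<lambda>k. falling (j - p - 1) (of_nat k + (of_nat N + of_nat i - of_nat p)) * path_coeff i N k p)"
      by (simp only:)
  qed
  then show ?case
    by (rule poly_below_antidifference) (auto intro!: sum.cong simp: algebra_simps)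
qed

lemma parameters_bounded: "\<exists>b. \<forall>j<n. l j \<le> real b"
proof -
  have "\<forall>j<n. l j \<le> real (nat \<lceil>Max (l ` {..<n})\<rceil>)"
  proof (intro allI impI)
    fix j assume "j < n"
    then have "l j \<le> Max (l ` {..<n})" by (intro Max_ge) auto
    then show "l j \<le> real (nat \<lceil>Max (l ` {..<n})\<rceil>)" by linarith
  qed
  then show ?thesis by blast
qed

definition single :: "nat \<Rightarrow> (complex \<Rightarrow> complex) \<Rightarrow> nat \<Rightarrow> complex \<Rightarrow> complex"
  where "single i f = (\<lambda>j. if j = i then f else 0)"

lemma single_mem: "i < n \<Longrightarrow> f \<in> carrier (H i) \<Longrightarrow> single i f \<in> carrier D"
  using complex_hilbert_space.zero_mem[OF hilbert] by (auto simp: single_def direct_sum_simps)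

lemma inner_single:
  assumes F: "F \<in> carrier D" and i: "i < n"
  shows "ip D F (single i f) = ip (H i) (F i) f"
proof -
  have "ip D F (single i f) = (\<Sum>j<n. if j = i then ip (H j) (F j) f else 0)"
    unfolding direct_sum_simps single_def
    using complex_hilbert_space.inner_zero_right[OF hilbert component_mem[OF F]]
    by (intro sum.cong refl) auto
  then show ?thesis using i by simp
qed

lemma hnorm_single:
  assumes i: "i < n" and f: "f \<in> carrier (H i)"
  shows "hnorm D (single i f) = hnorm (H i) f"
  using inner_single[OF single_mem[OF i f] i, of f] by (simp add: hnorm_def) (simp add: single_def)

text \<open>
  Each application of \<open>T\<close> lowers degrees by one, the monomials in \<open>Y\<close> have degrees below \<open>Q\<close>, and no
  degree is negative.
\<close>

lemma polynomial_nilpotent: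
  assumes j: "j < n" and Y: "Y \<in> carrier (H j)"
    and Q: "\<And>q. q + j \<ge> Q \<Longrightarrow> ip (H j) Y (disc_monom q) = 0"
  shows "(T ^^ Q) (single j Y) = 0"
proof
  let ?y = "single j Y"
  have y: "?y \<in> carrier D" by (rule single_mem[OF j Y])
  have TQ: "(T ^^ Q) ?y \<in> carrier D" by (rule D.funpow_mem[OF bounded y])
  fix i
  show "(T ^^ Q) ?y i = 0 i"
  proof (cases "i < n")
    case True
    interpret Hi: weighted_space "H i" "l i" by (rule weighted_space[OF True])
    have "(T ^^ Q) ?y i = 0"
    proof (rule Hi.total[OF component_mem[OF TQ True]])
      fix N
      have "coefficient ?y p (int (N + Q + i) - int p) = 0" if p: "p < n" for p
      proof (cases "p = j \<and> j \<le> N + Q + i")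
        case True
        then have "ip (H j) Y (disc_monom (N + Q + i - j)) = 0" by (intro Q) auto
        then show ?thesis using True by (simp add: coefficient_def single_def nat_diff_distrib flip: of_nat_diff of_nat_add)
      next
        case False
        interpret Hp: weighted_space "H p" "l p" by (rule weighted_space[OF p])
        show ?thesis using False by (auto simp: coefficient_def single_def Hp.inner_zero_left Hp.monom_mem)
      qed
      then have "coefficient ((T ^^ Q) ?y) i (int N) = 0"
        unfolding coefficient_power[OF y True] by simp
      then show "ip (H i) ((T ^^ Q) ?y i) (disc_monom N) = 0" by (simp add: coefficient_def)
    qed
    then show ?thesis by simp
  qed (use TQ in \<open>simp add: direct_sum_simps\<close>)
qed

text \<open>
  The test vector is \<open>Y = \<Sum>\<^sub>k cnj (c\<^sub>k R\<^sub>k) z\<^sup>P\<^sup>(\<^sup>k\<^sup>)\<close> in the \<open>j\<close>-th summand, where \<open>R\<^sub>k\<close> is the path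
  coefficient and \<open>P k = N + k + i - j\<close>.  Its monomials have different degrees, so in \<open>\<langle>\<phi>(T) Y, z\<^sup>N\<rangle>\<close>
  the \<open>k\<close>-th power of \<open>T\<close> meets only the \<open>k\<close>-th monomial.  Hence the inner product equals \<open>\<parallel>Y\<parallel>\<^sup>2\<close>, which
  is the sum in question, and the Cauchy--Schwarz inequality bounds it by \<open>M \<parallel>Y\<parallel> \<parallel>z\<^sup>N\<parallel>\<close>.
\<close>

lemma path_coeff_square_sum:
  assumes spec: "spectrum D T \<subseteq> cball 0 1"
    and B: "is_functional_calculus D T \<phi> B" "op_norm D B \<le> M"
    and \<phi>: "\<And>z. cmod z < 1 \<Longrightarrow> (\<lambda>k. of_real (c k) * z ^ k) sums \<phi> z"
    and ij: "i \<le> j" "j < n" and K: "j \<le> N + K + i"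
  shows "(\<Sum>k=K..L. (c k)\<^sup>2 * (cmod (path_coeff i N k j))\<^sup>2 / kernel_coeff (l j) (N + k + i - j))
    \<le> M\<^sup>2 / kernel_coeff (l i) N"
proof (cases "K \<le> L")
  case False
  interpret Hi: weighted_space "H i" "l i" by (rule weighted_space) (use ij in auto)
  show ?thesis using False Hi.weight_pos[of N] by simp
next
  case KL: True
  have i: "i < n" using ij by simp
  interpret Hi: weighted_space "H i" "l i" by (rule weighted_space[OF i])
  interpret Hj: weighted_space "H j" "l j" by (rule weighted_space[OF ij(2)])
  let ?R = "path_coeff i N"
  let ?\<kappa> = "kernel_coeff (l j)"
  \<comment> \<open>\<open>P k\<close> is the index of the monomial met by \<open>T\<^sup>k\<close>; \<open>s\<close> is the inverse of \<open>P\<close>\<close>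
  define s where "s q = q + j - (N + i)" for q
  define P where "P k = N + k + i - j" for k
  define I where "I = {P K..P L}"
  have sP: "s (P k) = k" "P k \<in> I \<longleftrightarrow> k \<in> {K..L}" if "j \<le> N + k + i" for k
    using that K KL by (auto simp: s_def P_def I_def)
  have Ps: "P (s q) = q" "K \<le> s q" "s q \<le> L" if "q \<in> I" for q
    using that K KL by (auto simp: s_def P_def I_def)
  define z where "z q = cnj (of_real (c (s q)) * ?R (s q) j)" for q
  define Y where "Y = (\<Sum>q\<in>I. z q *\<^sub>C disc_monom q)"
  have Y: "Y \<in> carrier (H j)" unfolding Y_def by (rule Hj.comb_mem)
  have Yq: "ip (H j) Y (disc_monom q) = (if q \<in> I then z q * of_real (1 / ?\<kappa> q) else 0)" for q
    unfolding Y_def by (rule Hj.inner_comb) (simp add: I_def)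
  define S where "S = (\<Sum>k=K..L. (c k)\<^sup>2 * (cmod (?R k j))\<^sup>2 / ?\<kappa> (P k))"
  have normY: "(hnorm (H j) Y)\<^sup>2 = S"
  proof -
    have "(hnorm (H j) Y)\<^sup>2 = (\<Sum>q\<in>I. (cmod (z q))\<^sup>2 * (1 / ?\<kappa> q))"
      unfolding Y_def by (rule Hj.hnorm_comb) (simp add: I_def)
    also have "\<dots> = S"
      unfolding S_def using K
      by (intro sum.reindex_bij_witness[of _ P s])
        (auto simp: Ps sP z_def norm_mult power_mult_distrib)
    finally show ?thesis .
  qed
  let ?y = "single j Y" and ?x = "single i (disc_monom N)"
  have y: "?y \<in> carrier D" by (rule single_mem[OF ij(2) Y])
  have x: "?x \<in> carrier D" by (rule single_mem[OF i Hi.monom_mem])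
  define Q where "Q = Suc (N + L + i)"
  have nil: "(T ^^ Q) ?y = 0"
    by (rule polynomial_nilpotent[OF ij(2) Y]) (use K KL in \<open>auto simp: Yq Q_def I_def P_def\<close>)
  have ck: "coefficient ((T ^^ k) ?y) i (int N) = ?R k j * coefficient ?y j (int (N + k + i) - int j)" for k
  proof -
    have "?R k p * coefficient ?y p (int (N + k + i) - int p) =
        (if p = j then ?R k j * coefficient ?y j (int (N + k + i) - int j) else 0)" if p: "p \<in> {i..<n}" for p
    proof -
      interpret Hp: weighted_space "H p" "l p" by (rule weighted_space) (use p in auto)
      show ?thesis by (auto simp: coefficient_def single_def Hp.inner_zero_left Hp.monom_mem)
    qed
    then have "coefficient ((T ^^ k) ?y) i (int N) =
        (\<Sum>p\<in>{i..<n}. if p = j then ?R k j * coefficient ?y j (int (N + k + i) - int j) else 0)"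
      unfolding coefficient_power[OF y i] by (intro sum.cong refl)
    also have "\<dots> = ?R k j * coefficient ?y j (int (N + k + i) - int j)"
      using ij by (subst sum.delta) auto
    finally show ?thesis .
  qed
  have summand: "of_real (c k) * coefficient ((T ^^ k) ?y) i (int N) =
      (if k \<in> {K..L} then of_real ((c k)\<^sup>2 * (cmod (?R k j))\<^sup>2 / ?\<kappa> (P k)) else 0)" for k
  proof (cases "j \<le> N + k + i")
    case True
    then have "coefficient ?y j (int (N + k + i) - int j) = ip (H j) Y (disc_monom (P k))"
      by (simp add: coefficient_def single_def P_def nat_diff_distrib flip: of_nat_diff of_nat_add)
    also have "\<dots> = (if k \<in> {K..L} then z (P k) * of_real (1 / ?\<kappa> (P k)) else 0)"
      by (simp only: Yq sP[OF True])
    finally show ?thesis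
      unfolding ck by (auto simp: z_def sP[OF True] complex_norm_square power2_eq_square[of "c k"]
          simp del: of_real_power)
  next
    case False
    then show ?thesis using K unfolding ck by (auto simp: coefficient_def)
  qed
  have "ip D (B ?y) ?x = (\<Sum>k<Q. of_real (c k) * ip D ((T ^^ k) ?y) ?x)"
    by (rule D.functional_calculus_nilpotent[OF B(1) bounded spec \<phi> y nil x])
  also have "\<dots> = (\<Sum>k<Q. of_real (c k) * coefficient ((T ^^ k) ?y) i (int N))"
    by (simp add: inner_single[OF D.funpow_mem[OF bounded y] i] coefficient_def)
  also have "\<dots> = (\<Sum>k\<in>{K..L}. of_real ((c k)\<^sup>2 * (cmod (?R k j))\<^sup>2 / ?\<kappa> (P k)))"
    unfolding summand by (rule sum.mono_neutral_cong_right) (auto simp: Q_def)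
  also have "\<dots> = of_real S" by (simp add: S_def)
  finally have "S = cmod (ip D (B ?y) ?x)"
    using normY by (metis norm_of_real abs_of_nonneg zero_le_power2)
  also have "\<dots> \<le> hnorm D (B ?y) * hnorm D ?x"
    using B(1) y x by (intro D.Cauchy_Schwarz) (auto simp: is_functional_calculus_def bounded_operator_def)
  also have "\<dots> \<le> (M * hnorm D ?y) * hnorm D ?x"
  proof (rule mult_right_mono)
    have "hnorm D (B ?y) \<le> op_norm D B * hnorm D ?y"
      using B(1) y by (intro D.hnorm_le_op_norm) (auto simp: is_functional_calculus_def)
    also have "\<dots> \<le> M * hnorm D ?y" using B(2) y by (intro mult_right_mono) auto
    finally show "hnorm D (B ?y) \<le> M * hnorm D ?y" .
  qed (use x in simp)
  finally have "S \<le> (M * hnorm (H j) Y) * hnorm (H i) (disc_monom N)"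
    by (simp add: hnorm_single i ij Y Hi.monom_mem)
  then have le: "hnorm (H j) Y * hnorm (H j) Y \<le> hnorm (H j) Y * (M * hnorm (H i) (disc_monom N))"
    unfolding normY[symmetric] by (simp add: power2_eq_square mult_ac)
  have hi: "(hnorm (H i) (disc_monom N))\<^sup>2 = 1 / kernel_coeff (l i) N"
    by (simp add: Hi.hnorm_sq Hi.monom_mem Hi.basis_inner)
  have "S \<le> M\<^sup>2 * (1 / kernel_coeff (l i) N)"
  proof (cases "hnorm (H j) Y = 0")
    case True
    then show ?thesis using normY Hi.weight_pos[of N] by simp
  next
    case False
    then have "hnorm (H j) Y > 0" using Hj.hnorm_ge_0[OF Y] by linarith
    then have "hnorm (H j) Y \<le> M * hnorm (H i) (disc_monom N)"
      using le by simp
    then have "(hnorm (H j) Y)\<^sup>2 \<le> (M * hnorm (H i) (disc_monom N))\<^sup>2"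
      using Y by (intro power_mono) auto
    then show ?thesis by (simp only: normY power_mult_distrib hi)
  qed
  then show ?thesis by (simp add: S_def P_def)
qed

text \<open>
  For fixed \<open>K\<close>, apply the square sum estimate over the block \<open>{K + 1..L}\<close> with the automorphism
  adapted to \<open>L\<close>.  Its coefficients there are of order \<open>1 / (K + 1)\<close>, so the sum over the block of the
  squared path coefficients, divided by the weights, is \<open>O((K + 1)\<^sup>2)\<close>.  Within the block the
  weights exceed the one for \<open>K\<close> at most by the factor \<open>W\<close>, and polynomiality in \<open>k\<close> turns the
  mean over the block into a bound at \<open>K\<close>.
\<close>

lemma path_coeff_bound:
  assumes bdd: "moebius_bounded D T"
  shows "\<exists>C\<ge>0. \<forall>i j N K. i \<le> j \<longrightarrow> j < n \<longrightarrow> j \<le> N + K + i \<longrightarrow>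
    (cmod (path_coeff i N K j))\<^sup>2 / kernel_coeff (l j) (N + K + i - j) \<le>
      C * (real K + 1) / kernel_coeff (l i) N"
proof -
  obtain M where spec: "spectrum D T \<subseteq> cball 0 1"
    and M: "\<And>\<phi>. \<phi> \<in> moeb \<Longrightarrow> \<exists>B. is_functional_calculus D T \<phi> B \<and> op_norm D B \<le> M"
    using bdd unfolding moebius_bounded_def by blast
  obtain b where b: "\<And>j. j < n \<Longrightarrow> l j \<le> real b" using parameters_bounded by blast
  define W where "W = (1 + real n * (real n + 1)) ^ b"
  have W: "W > 0" unfolding W_def by (intro zero_less_power) (simp add: add_pos_nonneg)
  define C where "C = 9 ^ n * (real n)\<^sup>2 * (16 * (real n + 1)\<^sup>2 * W * M\<^sup>2)"
  show ?thesis
  proof (intro exI[of _ C] conjI allI impI)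
    show "C \<ge> 0" using W by (simp add: C_def)
    fix i j N K assume ij: "i \<le> j" "j < n" and K: "j \<le> N + K + i"
    let ?R = "\<lambda>k. path_coeff i N k j"
    let ?\<kappa> = "kernel_coeff (l j)"
    define P where "P k = N + k + i - j" for k
    interpret Hi: weighted_space "H i" "l i" by (rule weighted_space) (use ij in auto)
    interpret Hj: weighted_space "H j" "l j" by (rule weighted_space[OF ij(2)])
    have kp: "kernel_coeff (l i) q > 0" "?\<kappa> q > 0" for q
      using kernel_coeff_pos Hi.parameter_pos Hj.parameter_pos by auto
    \<comment> \<open>the block that the averaging lemma samples for polynomials of degree less than \<open>n\<close>\<close>
    define L where "L = K + n * (K + 1)"
    have L1: "real L + 1 = (real n + 1) * (real K + 1)"
      by (simp add: L_def algebra_simps)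
    define a where "a = 1 - 1 / (2 * (real L + 1))"
    have a: "0 \<le> a" "a < 1" by (auto simp: a_def field_simps)
    define \<phi> where "\<phi> = Moebius_function 0 (of_real a)"
    have "\<phi> \<in> moeb" unfolding \<phi>_def by (rule Moebius_function_mem_moeb) (use a in simp)
    then obtain B where B: "is_functional_calculus D T \<phi> B" "op_norm D B \<le> M" using M by blast
    have ser: "(\<lambda>k. of_real (moebius_coeff a k) * z ^ k) sums \<phi> z" if "cmod z < 1" for z
      unfolding \<phi>_def by (rule Moebius_function_power_series[OF a that])
    have total: "(\<Sum>k=K+1..L. (moebius_coeff a k)\<^sup>2 * (cmod (?R k))\<^sup>2 / ?\<kappa> (P k)) \<le> M\<^sup>2 / kernel_coeff (l i) N"
      unfolding P_def by (rule path_coeff_square_sum[OF spec B ser ij]) (use K in auto)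
    have summand: "(1 / (4 * (real L + 1)))\<^sup>2 * ((cmod (?R k))\<^sup>2 / (?\<kappa> (P K) * W)) \<le>
        (moebius_coeff a k)\<^sup>2 * (cmod (?R k))\<^sup>2 / ?\<kappa> (P k)" if k: "k \<in> {K+1..L}" for k
    proof -
      have "(1 / (4 * (real L + 1)))\<^sup>2 \<le> (moebius_coeff a k)\<^sup>2"
        unfolding a_def by (intro power_mono moebius_coeff_lower) (use k in auto)
      moreover have "?\<kappa> (P k) \<le> ?\<kappa> (P K) * W"
      proof -
        have "?\<kappa> (P k) \<le> ?\<kappa> (P K) * ((real (P k) + 1) / (real (P K) + 1)) ^ b"
          by (rule kernel_coeff_growth) (use Hj.parameter_pos b ij k in \<open>auto simp: P_def\<close>)
        also have "\<dots> \<le> ?\<kappa> (P K) * W"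
          unfolding W_def
        proof (intro mult_left_mono power_mono)
          have "P k \<le> P K + n * (K + 1)" using k K by (auto simp: P_def L_def)
          also have "K + 1 \<le> (n + 1) * (P K + 1)"
          proof -
            have "K + 1 \<le> P K + j + 1" by (simp add: P_def)
            also have "\<dots> \<le> P K + 1 + n * 1" using ij by simp
            also have "\<dots> \<le> P K + 1 + n * (P K + 1)" by (intro add_left_mono mult_left_mono) auto
            finally show ?thesis by simp
          qed
          finally have "P k + 1 \<le> (1 + n * (n + 1)) * (P K + 1)" by (simp add: algebra_simps)
          then have "real (P k + 1) \<le> real ((1 + n * (n + 1)) * (P K + 1))" by (rule of_nat_mono)
          then show "(real (P k) + 1) / (real (P K) + 1) \<le> 1 + real n * (real n + 1)"
            by (simp add: divide_le_eq algebra_simps)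
        qed (use kp[of "P K"] in auto)
        finally show ?thesis .
      qed
      ultimately have "(1 / (4 * (real L + 1)))\<^sup>2 * ((cmod (?R k))\<^sup>2 / (?\<kappa> (P K) * W)) \<le>
          (moebius_coeff a k)\<^sup>2 * ((cmod (?R k))\<^sup>2 / ?\<kappa> (P k))"
        using kp W by (intro mult_mono divide_left_mono) (auto simp: less_imp_le)
      then show ?thesis by simp
    qed
    have "(\<Sum>k=K+1..L. (1 / (4 * (real L + 1)))\<^sup>2 * ((cmod (?R k))\<^sup>2 / (?\<kappa> (P K) * W)))
        \<le> M\<^sup>2 / kernel_coeff (l i) N"
      by (rule order_trans[OF sum_mono[OF summand] total])
    then have "(1 / (4 * (real L + 1)))\<^sup>2 * ((\<Sum>k=K+1..L. (cmod (?R k))\<^sup>2) / (?\<kappa> (P K) * W))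
        \<le> M\<^sup>2 / kernel_coeff (l i) N"
      by (simp only: sum_distrib_left sum_divide_distrib)
    then have sum_le: "(\<Sum>k=K+1..L. (cmod (?R k))\<^sup>2) \<le>
        16 * (real L + 1)\<^sup>2 * ?\<kappa> (P K) * W * (M\<^sup>2 / kernel_coeff (l i) N)"
    proof -
      have bound: "t \<le> 16 * x\<^sup>2 * q * W * r"
        if "(1 / (4 * x))\<^sup>2 * (t / (q * W)) \<le> r" "x > 0" "q > 0" for t x q r :: real
        using that W by (simp add: power_divide power_mult_distrib divide_le_eq mult_ac)
      show ?thesis
        by (rule bound) (use \<open>(1 / (4 * (real L + 1)))\<^sup>2 * _ \<le> _\<close> kp(2) in auto)
    qed
    have "poly_below n ?R"
      by (rule poly_below_mono[OF path_coeff_poly]) (use ij in auto)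
    from poly_below_le_average[OF this, of K]
    have "(real K + 1) * (cmod (?R K))\<^sup>2 \<le> 9 ^ n * (real n)\<^sup>2 * (\<Sum>k=K+1..L. (cmod (?R k))\<^sup>2)"
      unfolding L_def .
    also have "\<dots> \<le> 9 ^ n * (real n)\<^sup>2 *
        (16 * (real L + 1)\<^sup>2 * ?\<kappa> (P K) * W * (M\<^sup>2 / kernel_coeff (l i) N))"
      by (intro mult_left_mono sum_le) auto
    also have "\<dots> = (real K + 1) * (C * (real K + 1) / kernel_coeff (l i) N * ?\<kappa> (P K))"
      unfolding L1 C_def by (simp add: power_mult_distrib power2_eq_square mult_ac)
    finally have "(cmod (?R K))\<^sup>2 \<le> C * (real K + 1) / kernel_coeff (l i) N * ?\<kappa> (P K)"
      by (rule mult_left_le_imp_le) simp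
    then show "(cmod (?R K))\<^sup>2 / ?\<kappa> (N + K + i - j) \<le> C * (real K + 1) / kernel_coeff (l i) N"
      using kp(2)[of "P K"] by (simp add: pos_divide_le_eq P_def)
  qed
qed

text \<open>
  Each block of \<open>T\<^sup>K\<close> matches distinct monomials with distinct monomials, so the bounds on single
  entries bound the block: Bessel's inequality in the \<open>j\<close>-th space controls the sum over \<open>N\<close>, and
  the expansion in the \<open>i\<close>-th space recovers the norm.
\<close>

lemma power_component_bound:
  assumes C: "C \<ge> 0" and R: "\<And>i j N K. i \<le> j \<Longrightarrow> j < n \<Longrightarrow> j \<le> N + K + i \<Longrightarrow>
    (cmod (path_coeff i N K j))\<^sup>2 / kernel_coeff (l j) (N + K + i - j) \<le>
      C * (real K + 1) / kernel_coeff (l i) N"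
    and F: "F \<in> carrier D" and i: "i < n"
  shows "(hnorm (H i) ((T ^^ K) F i))\<^sup>2 \<le> real n * C * (real K + 1) * (hnorm D F)\<^sup>2"
proof -
  interpret Hi: weighted_space "H i" "l i" by (rule weighted_space[OF i])
  have TF: "(T ^^ K) F \<in> carrier D" by (rule D.funpow_mem[OF bounded F])
  have kp: "kernel_coeff (l j) q > 0" if "j < n" for j q
    using weighted_space[OF that] kernel_coeff_pos weighted_space.parameter_pos by blast
  define t where "t N j = (cmod (coefficient F j (int (N + K + i) - int j)))\<^sup>2 * kernel_coeff (l j) (N + K + i - j)" for N j
  have t: "(cmod (path_coeff i N K j * coefficient F j (int (N + K + i) - int j)))\<^sup>2 * kernel_coeff (l i) N
      \<le> C * (real K + 1) * t N j" if j: "j \<in> {i..<n}" for j N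
  proof (cases "j \<le> N + K + i")
    case True
    have "(cmod (path_coeff i N K j))\<^sup>2 * kernel_coeff (l i) N \<le> C * (real K + 1) * kernel_coeff (l j) (N + K + i - j)"
      using R[OF _ _ True] j kp[of j "N + K + i - j"] kp[OF i, of N] by (simp add: field_simps)
    then have "(cmod (path_coeff i N K j))\<^sup>2 * kernel_coeff (l i) N * (cmod (coefficient F j (int (N + K + i) - int j)))\<^sup>2
        \<le> C * (real K + 1) * kernel_coeff (l j) (N + K + i - j) * (cmod (coefficient F j (int (N + K + i) - int j)))\<^sup>2"
      by (rule mult_right_mono) simp
    then show ?thesis by (simp add: t_def norm_mult power_mult_distrib mult_ac)
  next
    case False
    then show ?thesis by (simp add: t_def coefficient_def)
  qed
  have bessel: "(\<Sum>N<Z. t N j) \<le> (hnorm (H j) (F j))\<^sup>2" if j: "j < n" for j Z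
  proof -
    interpret Hj: weighted_space "H j" "l j" by (rule weighted_space[OF j])
    define J where "J = {N\<in>{..<Z}. j \<le> N + K + i}"
    have inj: "inj_on (\<lambda>N. N + K + i - j) J" by (auto simp: inj_on_def J_def)
    have "(\<Sum>N<Z. t N j) = (\<Sum>N\<in>J. t N j)"
      by (rule sum.mono_neutral_right) (auto simp: J_def t_def coefficient_def)
    also have "\<dots> = (\<Sum>N\<in>J. (cmod (ip (H j) (F j) (disc_monom (N + K + i - j))))\<^sup>2 /
        (1 / kernel_coeff (l j) (N + K + i - j)))"
      by (intro sum.cong) (auto simp: t_def coefficient_def J_def nat_diff_distrib simp flip: of_nat_diff of_nat_add)
    also have "\<dots> = (\<Sum>q\<in>(\<lambda>N. N + K + i - j) ` J. (cmod (ip (H j) (F j) (disc_monom q)))\<^sup>2 /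
        (1 / kernel_coeff (l j) q))"
      by (simp add: sum.reindex[OF inj])
    also have "\<dots> \<le> (hnorm (H j) (F j))\<^sup>2"
      by (rule Hj.Bessel) (auto simp: J_def component_mem[OF F j])
    finally show ?thesis .
  qed
  show ?thesis
  proof (rule Hi.hnorm_sq_le[OF component_mem[OF TF i]])
    fix Z
    have "(\<Sum>N<Z. (cmod (ip (H i) ((T ^^ K) F i) (disc_monom N)))\<^sup>2 / (1 / kernel_coeff (l i) N)) \<le>
        (\<Sum>N<Z. real n * (\<Sum>j\<in>{i..<n}. C * (real K + 1) * t N j))"
    proof (rule sum_mono)
      fix N
      have "ip (H i) ((T ^^ K) F i) (disc_monom N) = coefficient ((T ^^ K) F) i (int N)"
        by (simp add: coefficient_def)
      also have "\<dots> = (\<Sum>j\<in>{i..<n}. path_coeff i N K j * coefficient F j (int (N + K + i) - int j))"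
        by (rule coefficient_power[OF F i])
      finally have "(cmod (ip (H i) ((T ^^ K) F i) (disc_monom N)))\<^sup>2 \<le>
          (\<Sum>j\<in>{i..<n}. 1 * cmod (path_coeff i N K j * coefficient F j (int (N + K + i) - int j)))\<^sup>2"
        by (simp add: power_mono norm_sum)
      also have "\<dots> \<le> (\<Sum>j\<in>{i..<n}. 1\<^sup>2) *
          (\<Sum>j\<in>{i..<n}. (cmod (path_coeff i N K j * coefficient F j (int (N + K + i) - int j)))\<^sup>2)"
        by (rule Cauchy_Schwarz_ineq_sum)
      also have "\<dots> \<le> real n *
          (\<Sum>j\<in>{i..<n}. (cmod (path_coeff i N K j * coefficient F j (int (N + K + i) - int j)))\<^sup>2)"
        by (intro mult_right_mono sum_nonneg) auto
      finally have "(cmod (ip (H i) ((T ^^ K) F i) (disc_monom N)))\<^sup>2 * kernel_coeff (l i) N \<le> real n *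
          (\<Sum>j\<in>{i..<n}. (cmod (path_coeff i N K j * coefficient F j (int (N + K + i) - int j)))\<^sup>2) * kernel_coeff (l i) N"
        by (rule mult_right_mono) (use kp[OF i, of N] in simp)
      also have "\<dots> = real n *
          (\<Sum>j\<in>{i..<n}. (cmod (path_coeff i N K j * coefficient F j (int (N + K + i) - int j)))\<^sup>2 * kernel_coeff (l i) N)"
        by (simp only: mult.assoc sum_distrib_right)
      also have "\<dots> \<le> real n * (\<Sum>j\<in>{i..<n}. C * (real K + 1) * t N j)"
        by (intro mult_left_mono sum_mono t) auto
      finally show "(cmod (ip (H i) ((T ^^ K) F i) (disc_monom N)))\<^sup>2 / (1 / kernel_coeff (l i) N) \<le>
          real n * (\<Sum>j\<in>{i..<n}. C * (real K + 1) * t N j)" by simp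
    qed
    also have "\<dots> = real n * C * (real K + 1) * (\<Sum>j\<in>{i..<n}. \<Sum>N<Z. t N j)"
      unfolding sum_distrib_left[symmetric] by (subst sum.swap) (simp add: mult_ac)
    also have "\<dots> \<le> real n * C * (real K + 1) * (\<Sum>j\<in>{i..<n}. (hnorm (H j) (F j))\<^sup>2)"
      using C by (intro mult_left_mono sum_mono bessel) auto
    also have "\<dots> \<le> real n * C * (real K + 1) * (\<Sum>j<n. (hnorm (H j) (F j))\<^sup>2)"
      using C by (intro mult_left_mono sum_mono2) auto
    finally show "(\<Sum>N<Z. (cmod (ip (H i) ((T ^^ K) F i) (disc_monom N)))\<^sup>2 / (1 / kernel_coeff (l i) N))
        \<le> real n * C * (real K + 1) * (hnorm D F)\<^sup>2"
      by (simp only: norm_D[OF F])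
  qed
qed

theorem power_growth:
  assumes "moebius_bounded D T"
  shows "\<exists>c>0. \<forall>k. op_norm D (T ^^ k) \<le> c * (real k + 1) powr (1/2)"
proof -
  obtain C where C: "C \<ge> 0" and R: "\<And>i j N K. i \<le> j \<Longrightarrow> j < n \<Longrightarrow> j \<le> N + K + i \<Longrightarrow>
    (cmod (path_coeff i N K j))\<^sup>2 / kernel_coeff (l j) (N + K + i - j) \<le>
      C * (real K + 1) / kernel_coeff (l i) N"
    using path_coeff_bound[OF assms] by blast
  \<comment> \<open>the summand \<open>1\<close> only serves to make \<open>c\<close> positive\<close>
  define c where "c = real n * sqrt C + 1"
  have c: "c > 0" using C by (simp add: c_def add_nonneg_pos)
  have "op_norm D (T ^^ K) \<le> c * (real K + 1) powr (1/2)" for K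
  proof (rule D.op_norm_le)
    fix F assume F: "F \<in> carrier D"
    have TF: "(T ^^ K) F \<in> carrier D" by (rule D.funpow_mem[OF bounded F])
    have "(hnorm D ((T ^^ K) F))\<^sup>2 = (\<Sum>i<n. (hnorm (H i) ((T ^^ K) F i))\<^sup>2)"
      by (rule norm_D[OF TF])
    also have "\<dots> \<le> (\<Sum>i<n. real n * C * (real K + 1) * (hnorm D F)\<^sup>2)"
      by (intro sum_mono power_component_bound[OF C R F]) auto
    also have "\<dots> = (real n * sqrt C * sqrt (real K + 1) * hnorm D F)\<^sup>2"
      using C by (simp add: power_mult_distrib power2_eq_square[of "real n"])
    finally have "hnorm D ((T ^^ K) F) \<le> real n * sqrt C * sqrt (real K + 1) * hnorm D F"
      by (rule power2_le_imp_le) (use C F in simp)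
    also have "\<dots> \<le> c * sqrt (real K + 1) * hnorm D F"
      using F by (intro mult_right_mono) (auto simp: c_def)
    finally show "hnorm D ((T ^^ K) F) \<le> c * (real K + 1) powr (1/2) * hnorm D F"
      by (simp add: powr_half_sqrt)
  qed (use c in simp)
  then show ?thesis using c by blast
qed

end

theorem corollary4p9:
  fixes n :: nat and l :: "nat \<Rightarrow> real"
    and H :: "nat \<Rightarrow> (complex \<Rightarrow> complex) inner_space"
    and T :: "(nat \<Rightarrow> complex \<Rightarrow> complex) \<Rightarrow> nat \<Rightarrow> complex \<Rightarrow> complex"
  assumes "quasi_homogeneous n l H T"
    and "moebius_bounded (direct_sum n H) T"
  shows "\<exists>c>0. \<forall>k::nat. op_norm (direct_sum n H) (T ^^ k) \<le> c * (real k + 1) powr (1/2)"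
proof -
  have qh: "0 < l 0" "\<And>i. Suc i < n \<Longrightarrow> l i \<le> l (Suc i)" "\<And>i. i < n \<Longrightarrow> is_weighted_space (l i) (H i)"
    "bounded_operator (direct_sum n H) (direct_sum n H) T"
    using assms(1) unfolding quasi_homogeneous_def by auto
  obtain A m where
    A: "\<And>i j. i < n \<Longrightarrow> j < n \<Longrightarrow> bounded_operator (H j) (H i) (A i j)"
      "\<And>i. i < n \<Longrightarrow> is_adjoint (H i) mult_z (A i i)"
      "\<And>i j w. i < j \<Longrightarrow> j < n \<Longrightarrow> w \<in> ball 0 1 \<Longrightarrow>
        A i j (disc_kernel (l j) w) = (m i j :: complex) *\<^sub>C dbar_kernel (j - i - 1) (l i) w"
      "\<And>i j f. j < i \<Longrightarrow> i < n \<Longrightarrow> f \<in> carrier (H j) \<Longrightarrow> A i j f = 0"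
      "\<And>F i. F \<in> carrier (direct_sum n H) \<Longrightarrow> i < n \<Longrightarrow> T F i = (\<Sum>j<n. A i j (F j))"
  proof -
    from assms(1) obtain A m where
        "\<forall>i<n. \<forall>j<n. bounded_operator (H j) (H i) (A i j)"
        "\<forall>i<n. is_adjoint (H i) mult_z (A i i)"
        "\<forall>i j. i < j \<and> j < n \<longrightarrow> (\<forall>w\<in>ball 0 1.
          A i j (disc_kernel (l j) w) = (m i j :: complex) *\<^sub>C dbar_kernel (j - i - 1) (l i) w)"
        "\<forall>i j. j < i \<and> i < n \<longrightarrow> (\<forall>f\<in>carrier (H j). A i j f = 0)"
        "\<forall>F\<in>carrier (direct_sum n H). \<forall>i<n. T F i = (\<Sum>j<n. A i j (F j))"
      unfolding quasi_homogeneous_def by (elim conjE exE)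
    then show ?thesis by (intro that[of A m]) simp_all
  qed
  have pos: "l i > 0" if "i < n" for i
    using that
  proof (induction i)
    case (Suc i)
    then show ?case using qh(2)[of i] by simp
  qed (use qh in simp)
  have "quasi_homogeneous_operator n l H T A m"
  proof (rule quasi_homogeneous_operator.intro)
    fix i assume i: "i < n"
    have "complex_hilbert_space (H i)" using qh(3)[OF i] unfolding is_weighted_space_def by blast
    moreover have "bounded_operator (H i) (H i) mult_z"
      using A(2)[OF i] unfolding is_adjoint_def by blast
    ultimately show "weighted_space (H i) (l i)"
      using qh(3)[OF i] pos[OF i]
      by (intro weighted_space.intro weighted_space_axioms.intro)
  qed (use qh A in auto)
  then show ?thesis by (rule quasi_homogeneous_operator.power_growth[OF _ assms(2)])
qed

end
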